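(* Let $R\subset S$ be an integral FCP extension of commutative rings. Then the following conditions are equivalent: (1) $R\subset S$ is u-closed; (2) $R\subset S$ is an $i$-extension; (3) ${}_S^+R={}_S^tR$. If these conditions are satisfied, any minimal subextension of $R\subset S$ (that is, any minimal extension $T\subset U$ with $T,U\in[R,S]$) is either ramified or inert.
   Context: All rings are commutative and unital; $\subset$ denotes proper inclusion. $[R,S]$ is the set of all $R$-subalgebras of $S$, ordered by inclusion; $R\subseteq S$ has FCP if each chain in $[R,S]$ is finite. $R\subseteq S$ is an $i$-extension if $\mathrm{Spec}(S)\to\mathrm{Spec}(R)$ is injective. $R\subseteq S$ is u-closed (anodal) if every $b\in S$ with $b^2-b\in R$ and $b^3-b^2\in R$ lies in $R$. An integral extension is infra-integral if all its residual field extensions $\kappa_R(Q\cap R)\to\kappa_S(Q)$ ($Q\in\mathrm{Spec}(S)$) are isomorphisms, and subintegral if moreover it is an $i$-extension. The seminormalization ${}_S^+R$ (resp. t-closure ${}_S^tR$) is the greatest $B\in[R,S]$ such that $R\subseteq B$ is subintegral (resp. infra-integral). An extension $T\subset U$ is minimal if $[T,U]=\{T,U\}$. A finite minimal extension $T\subset U$ has conductor $M=(T:U)\in\mathrm{Max}(T)$ and is exactly one of: inert ($M\in\mathrm{Max}(U)$ and $T/M\to U/M$ is a minimal field extension); decomposed (there are $M_1,M_2\in\mathrm{Max}(U)$, with $M=M_1\cap M_2$, $M_1\ne M_2$, and $T/M\to U/M_1$, $T/M\to U/M_2$ isomorphisms); ramified (there is $M'\in\mathrm{Max}(U)$ with $M'^2\subseteq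 M\subset M'$, $[U/M:T/M]=2$ and $T/M\to U/M'$ an isomorphism). *)

theory Defs
  imports "HOL-Algebra.Polynomials" "HOL-Algebra.Embedded_Algebras" "HOL-Algebra.Ideal_Product"
    "HOL-Algebra.QuotRing"
begin

text \<open>
  An extension \<open>T \<subseteq> U\<close> is given by two subrings \<open>T\<close>, \<open>U\<close> of an ambient commutative ring \<open>A\<close>;
  the ring structure of a subring \<open>T\<close> is \<open>A\<lparr>carrier := T\<rparr>\<close>.
\<close>

abbreviation sub_ring :: "('a, 'b) ring_scheme \<Rightarrow> 'a set \<Rightarrow> ('a, 'b) ring_scheme" where
  "sub_ring A T \<equiv> A\<lparr>carrier := T\<rparr>"

definition intermediate_rings :: "('a, 'b) ring_scheme \<Rightarrow> 'a set \<Rightarrow> 'a set \<Rightarrow> 'a set set" where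
  "intermediate_rings A T U = {B. subring B A \<and> T \<subseteq> B \<and> B \<subseteq> U}"

definition FCP :: "('a, 'b) ring_scheme \<Rightarrow> 'a set \<Rightarrow> 'a set \<Rightarrow> bool" where
  "FCP A T U \<longleftrightarrow> (\<forall>C. subset.chain (intermediate_rings A T U) C \<longrightarrow> finite C)"

definition minimal_extension :: "('a, 'b) ring_scheme \<Rightarrow> 'a set \<Rightarrow> 'a set \<Rightarrow> bool" where
  "minimal_extension A T U \<longleftrightarrow> T \<subset> U \<and> intermediate_rings A T U = {T, U}"

definition integral_extension :: "('a, 'b) ring_scheme \<Rightarrow> 'a set \<Rightarrow> 'a set \<Rightarrow> bool" where
  "integral_extension A T U \<longleftrightarrow>
     (\<forall>x\<in>U. \<exists>p\<in>carrier (univ_poly A T).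
        p \<noteq> [] \<and> lead_coeff p = \<one>\<^bsub>A\<^esub> \<and> ring.eval A p x = \<zero>\<^bsub>A\<^esub>)"

definition finite_extension :: "('a, 'b) ring_scheme \<Rightarrow> 'a set \<Rightarrow> 'a set \<Rightarrow> bool" where
  "finite_extension A T U \<longleftrightarrow> (\<exists>us. set us \<subseteq> U \<and> ring.Span A T us = U)"

definition u_closed :: "('a, 'b) ring_scheme \<Rightarrow> 'a set \<Rightarrow> 'a set \<Rightarrow> bool" where
  "u_closed A T U \<longleftrightarrow>
     (\<forall>b\<in>U. b [^]\<^bsub>A\<^esub> (2::nat) \<ominus>\<^bsub>A\<^esub> b \<in> T \<longrightarrow>
            b [^]\<^bsub>A\<^esub> (3::nat) \<ominus>\<^bsub>A\<^esub> b [^]\<^bsub>A\<^esub> (2::nat) \<in> T \<longrightarrow> b \<in> T)"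

definition Spec :: "('a, 'b) ring_scheme \<Rightarrow> 'a set set" where
  "Spec A = {P. primeideal P A}"

definition Max_Spec :: "('a, 'b) ring_scheme \<Rightarrow> 'a set set" where
  "Max_Spec A = {M. maximalideal M A}"

definition i_extension :: "('a, 'b) ring_scheme \<Rightarrow> 'a set \<Rightarrow> 'a set \<Rightarrow> bool" where
  "i_extension A T U \<longleftrightarrow> inj_on (\<lambda>Q. Q \<inter> T) (Spec (sub_ring A U))"

text \<open>The fraction \<open>a / s\<close> over a domain \<open>D\<close>, as an equivalence class of pairs.\<close>

definition fraction_class :: "('a, 'b) ring_scheme \<Rightarrow> 'a \<Rightarrow> 'a \<Rightarrow> ('a \<times> 'a) set" where
  "fraction_class D a s = {(b, t). b \<in> carrier D \<and> t \<in> carrier D - {\<zero>\<^bsub>D\<^esub>} \<and> a \<otimes>\<^bsub>D\<^esub> t = b \<otimes>\<^bsub>D\<^esub> s}"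

definition fraction_field :: "('a, 'b) ring_scheme \<Rightarrow> ('a \<times> 'a) set ring" where
  "fraction_field D =
     \<lparr>carrier = {fraction_class D a s | a s. a \<in> carrier D \<and> s \<in> carrier D - {\<zero>\<^bsub>D\<^esub>}},
      mult = (\<lambda>x y. \<Union>(a, s)\<in>x. \<Union>(b, t)\<in>y. fraction_class D (a \<otimes>\<^bsub>D\<^esub> b) (s \<otimes>\<^bsub>D\<^esub> t)),
      one = fraction_class D \<one>\<^bsub>D\<^esub> \<one>\<^bsub>D\<^esub>,
      zero = fraction_class D \<zero>\<^bsub>D\<^esub> \<one>\<^bsub>D\<^esub>,
      add = (\<lambda>x y. \<Union>(a, s)\<in>x. \<Union>(b, t)\<in>y.
               fraction_class D (a \<otimes>\<^bsub>D\<^esub> t \<oplus>\<^bsub>D\<^esub> b \<otimes>\<^bsub>D\<^esub> s) (s \<otimes>\<^bsub>D\<^esub> t))\<rparr>"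

text \<open>The map \<open>a / s \<mapsto> h a / h s\<close> of fraction fields induced by an injective homomorphism
  \<open>h\<close> into a domain \<open>E\<close>.\<close>

definition fraction_map ::
    "('c, 'd) ring_scheme \<Rightarrow> ('a \<Rightarrow> 'c) \<Rightarrow> ('a \<times> 'a) set \<Rightarrow> ('c \<times> 'c) set" where
  "fraction_map E h x = (\<Union>(a, s)\<in>x. fraction_class E (h a) (h s))"

definition residue_field :: "('a, 'b) ring_scheme \<Rightarrow> 'a set \<Rightarrow> ('a set \<times> 'a set) set ring" where
  "residue_field A P = fraction_field (A Quot P)"

text \<open>The canonical map \<open>T/P \<rightarrow> U/Q\<close>, \<open>P + x \<mapsto> Q + x\<close>, for ideals \<open>P \<subseteq> Q\<close> of \<open>T\<close> and \<open>U\<close>;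
  note that \<open>Q + (P + x) = Q + x\<close>.\<close>

definition quot_map :: "('a, 'b) ring_scheme \<Rightarrow> 'a set \<Rightarrow> 'a set \<Rightarrow> 'a set" where
  "quot_map A Q c = Q <+>\<^bsub>A\<^esub> c"

definition residue_map ::
    "('a, 'b) ring_scheme \<Rightarrow> 'a set \<Rightarrow> 'a set \<Rightarrow> ('a set \<times> 'a set) set \<Rightarrow> ('a set \<times> 'a set) set" where
  "residue_map A U Q = fraction_map (sub_ring A U Quot Q) (quot_map A Q)"

definition infra_integral :: "('a, 'b) ring_scheme \<Rightarrow> 'a set \<Rightarrow> 'a set \<Rightarrow> bool" where
  "infra_integral A T U \<longleftrightarrow> integral_extension A T U \<and>
     (\<forall>Q\<in>Spec (sub_ring A U).
        residue_map A U Q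
          \<in> ring_iso (residue_field (sub_ring A T) (Q \<inter> T)) (residue_field (sub_ring A U) Q))"

definition subintegral :: "('a, 'b) ring_scheme \<Rightarrow> 'a set \<Rightarrow> 'a set \<Rightarrow> bool" where
  "subintegral A T U \<longleftrightarrow> infra_integral A T U \<and> i_extension A T U"

definition seminormalization :: "('a, 'b) ring_scheme \<Rightarrow> 'a set \<Rightarrow> 'a set \<Rightarrow> 'a set" where
  "seminormalization A T U = (GREATEST B. B \<in> intermediate_rings A T U \<and> subintegral A T B)"

definition t_closure :: "('a, 'b) ring_scheme \<Rightarrow> 'a set \<Rightarrow> 'a set \<Rightarrow> 'a set" where
  "t_closure A T U = (GREATEST B. B \<in> intermediate_rings A T U \<and> infra_integral A T B)"

definition conductor :: "('a, 'b) ring_scheme \<Rightarrow> 'a set \<Rightarrow> 'a set \<Rightarrow> 'a set" where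
  "conductor A T U = {x \<in> U. \<forall>u\<in>U. x \<otimes>\<^bsub>A\<^esub> u \<in> T}"

text \<open>In the next two definitions, with \<open>M\<close> the conductor, the field \<open>T/M\<close> is regarded as a
  subring of \<open>U/M\<close> through its image under the canonical map.\<close>

definition inert :: "('a, 'b) ring_scheme \<Rightarrow> 'a set \<Rightarrow> 'a set \<Rightarrow> bool" where
  "inert A T U \<longleftrightarrow> finite_extension A T U \<and> minimal_extension A T U \<and>
     (let M = conductor A T U in
        M \<in> Max_Spec (sub_ring A T) \<and> M \<in> Max_Spec (sub_ring A U) \<and>
        minimal_extension (sub_ring A U Quot M)
          (quot_map A M ` carrier (sub_ring A T Quot M)) (carrier (sub_ring A U Quot M)))"

definition ramified :: "('a, 'b) ring_scheme \<Rightarrow> 'a set \<Rightarrow> 'a set \<Rightarrow> bool" where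
  "ramified A T U \<longleftrightarrow> finite_extension A T U \<and> minimal_extension A T U \<and>
     (let M = conductor A T U in
        M \<in> Max_Spec (sub_ring A T) \<and>
        (\<exists>M'\<in>Max_Spec (sub_ring A U).
           ideal_prod (sub_ring A U) M' M' \<subseteq> M \<and> M \<subset> M' \<and>
           ring.dimension (sub_ring A U Quot M) 2
             (quot_map A M ` carrier (sub_ring A T Quot M)) (carrier (sub_ring A U Quot M)) \<and>
           quot_map A M' \<in> ring_iso (sub_ring A T Quot M) (sub_ring A U Quot M')))"

end

theory Submission
  imports Defs "HOL-Algebra.Generated_Rings"
begin

text \<open>
  Strong \<open>\<pi>\<close>-regularity is the key to (1) \<open>\<Rightarrow>\<close> (2): FCP implies that for every \<open>x \<in> S\<close> there are
  \<open>n\<close> and \<open>y\<close> with \<open>x\<^sup>n (1 - y x) \<in> (R : S)\<close>. One descends from \<open>S\<close> along minimal steps \<open>B \<subset> C\<close>,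
  whose conductor is a maximal ideal of \<open>B\<close> by Nakayama's lemma. Then \<open>e = (y x)\<^sup>n\<close> is idempotent
  modulo \<open>(R : S)\<close>, hence lies in \<open>R\<close> if \<open>R \<subset> S\<close> is u-closed. If \<open>x\<close> lies in one of two primes over
  the same prime of \<open>R\<close> and not in the other, then so does \<open>e\<close>, a contradiction.

  Conversely, let \<open>b \<in> S\<close> violate u-closedness and put \<open>c = b\<^sup>2 - b\<close>. Then \<open>R[b] = R + R b\<close>, and
  every prime \<open>M\<close> of \<open>R\<close> containing the conductor \<open>(R : R[b])\<close>, and hence \<open>c\<close>, has the two extensions
  \<open>M + R b\<close> and \<open>M + R (1 - b)\<close>; by lying over, \<open>R \<subset> S\<close> is not an i-extension. Moreover \<open>R[b]\<close> is
  infra-integral over \<open>R\<close>, so \<open>b\<close> lies in the t-closure, whereas a subintegral extension of \<open>R\<close> is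
  an i-extension, hence u-closed, and cannot contain \<open>b\<close>.

  For a minimal i-extension \<open>T \<subset> U\<close> with conductor \<open>M\<close>, an element \<open>y \<notin> M\<close> with \<open>y\<^sup>2 \<in> M\<close> gives
  \<open>U = T + T y\<close> with maximal ideal \<open>M + T y\<close> (ramified). If there is none, the idempotents obtained
  from \<open>\<pi>\<close>-regularity modulo \<open>M\<close> lie in \<open>T\<close> and are trivial modulo \<open>M\<close>, so \<open>U/M\<close> is a field (inert).
\<close>

subsection \<open>Subrings, modules over subrings and ideals of subrings\<close>

locale cring_subring = cring R for R (structure) and U +
  assumes is_subring: "subring U R"
begin

lemma subset_carrier: "U \<subseteq> carrier R"
  using is_subring by (rule subringE)

text \<open>The attribute lets \<open>algebra\<close> derive its carrier conditions from membership in \<open>U\<close>.\<close>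

lemma mem_carrier [simp, algebra cring "zero R" "add R" "a_inv R" "a_minus R" "one R" "mult R"]:
  "x \<in> U \<Longrightarrow> x \<in> carrier R"
  using subset_carrier by blast

declare nat_pow_closed
  [algebra cring "zero R" "add R" "a_inv R" "a_minus R" "one R" "mult R"]

lemma zero_mem [simp]: "\<zero> \<in> U"
  and one_mem [simp]: "\<one> \<in> U"
  and add_mem [simp]: "\<lbrakk>x \<in> U; y \<in> U\<rbrakk> \<Longrightarrow> x \<oplus> y \<in> U"
  and mult_mem [simp]: "\<lbrakk>x \<in> U; y \<in> U\<rbrakk> \<Longrightarrow> x \<otimes> y \<in> U"
  and neg_mem [simp]: "x \<in> U \<Longrightarrow> \<ominus> x \<in> U"
  using is_subring by (simp_all add: subringE)

lemma minus_mem [simp]: "\<lbrakk>x \<in> U; y \<in> U\<rbrakk> \<Longrightarrow> x \<ominus> y \<in> U"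
  by (simp add: a_minus_def)

lemma pow_mem [simp]: "x \<in> U \<Longrightarrow> x [^] (n::nat) \<in> U"
  by (induct n) simp_all

lemma eval_mem: "\<lbrakk>set cs \<subseteq> U; x \<in> U\<rbrakk> \<Longrightarrow> eval cs x \<in> U"
  by (induct cs) simp_all

lemma is_cring_subring: "cring (sub_ring R U)"
  using subcring_iff subcringI'[OF is_subring] subringE(1)[OF is_subring] by blast

lemma a_inv_subring: "x \<in> U \<Longrightarrow> \<ominus>\<^bsub>sub_ring R U\<^esub> x = \<ominus> x"
  using cring.axioms(1)[OF is_cring_subring, THEN ring.is_abelian_group,
      THEN abelian_group.minus_equality, of "\<ominus> x" x]
  by (simp add: l_neg)

end

lemma (in cring) cring_subringI: "subring U R \<Longrightarrow> cring_subring R U"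
  by (intro cring_subring.intro cring_subring_axioms.intro is_cring)

lemma (in ring) Span_simps [simp]:
  "Span K [] = {\<zero>}" "Span K (u # us) = line_extension K u (Span K us)"
  by simp_all

declare (in ring) Span.simps [simp del]

locale subring_module = cring R + T: cring_subring R T for R (structure) and T and N +
  assumes subset_carrier: "N \<subseteq> carrier R"
    and zero_mem [simp]: "\<zero> \<in> N"
    and add_mem [simp]: "\<lbrakk>x \<in> N; y \<in> N\<rbrakk> \<Longrightarrow> x \<oplus> y \<in> N"
    and smult_mem [simp]: "\<lbrakk>t \<in> T; x \<in> N\<rbrakk> \<Longrightarrow> t \<otimes> x \<in> N"
begin

lemma mem_carrier [simp, algebra cring "zero R" "add R" "a_inv R" "a_minus R" "one R" "mult R"]:
  "x \<in> N \<Longrightarrow> x \<in> carrier R"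
  using subset_carrier by blast

lemma smult_mem_right [simp]: "\<lbrakk>x \<in> N; t \<in> T\<rbrakk> \<Longrightarrow> x \<otimes> t \<in> N"
  using smult_mem[of t x] by (simp add: m_comm)

lemma neg_mem [simp]:
  assumes "x \<in> N"
  shows "\<ominus> x \<in> N"
proof -
  have "\<ominus> x = (\<ominus> \<one>) \<otimes> x" using assms by algebra
  then show ?thesis using assms by simp
qed

lemma minus_mem [simp]: "\<lbrakk>x \<in> N; y \<in> N\<rbrakk> \<Longrightarrow> x \<ominus> y \<in> N"
  by (simp add: a_minus_def)

lemma pow_cong:
  assumes "a \<in> T" "b \<in> T" "a \<ominus> b \<in> N"
  shows "a [^] (n::nat) \<ominus> b [^] n \<in> N"
proof (induct n)
  case 0
  then show ?case by (simp add: a_minus_def r_neg)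
next
  case (Suc n)
  have "a [^] Suc n \<ominus> b [^] Suc n = a \<otimes> (a [^] n \<ominus> b [^] n) \<oplus> b [^] n \<otimes> (a \<ominus> b)"
    unfolding nat_pow_Suc using assms(1,2) by algebra
  also have "\<dots> \<in> N" using Suc assms by simp
  finally show ?case .
qed

lemma mem_line_extension: "\<lbrakk>t \<in> T; x \<in> N\<rbrakk> \<Longrightarrow> t \<otimes> b \<oplus> x \<in> line_extension T b N"
  unfolding line_extension_mem_iff by blast

lemma line_extension_superset:
  assumes "b \<in> carrier R"
  shows "N \<subseteq> line_extension T b N" and "b \<in> line_extension T b N"
proof
  fix x assume "x \<in> N"
  then show "x \<in> line_extension T b N"
    using mem_line_extension[of \<zero> x b] assms by simp
next
  show "b \<in> line_extension T b N"
    using mem_line_extension[of \<one> \<zero> b] assms by simp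
qed

lemma ex_diff_mem_line_extension:
  assumes b: "b \<in> carrier R" and u: "u \<in> line_extension T b T"
  shows "\<exists>x\<in>T. u \<ominus> x \<in> line_extension T b N"
proof -
  obtain t x where tx: "t \<in> T" "x \<in> T" "u = t \<otimes> b \<oplus> x"
    using u unfolding line_extension_mem_iff by blast
  have "u \<ominus> x = t \<otimes> b \<oplus> \<zero>" unfolding tx(3) using tx(1,2) b by algebra
  then have "u \<ominus> x \<in> line_extension T b N"
    using mem_line_extension[OF tx(1) zero_mem, of b] by (simp only:)
  then show ?thesis using tx(2) by blast
qed

lemma line_extension_module:
  assumes b: "b \<in> carrier R"
  shows "subring_module R T (line_extension T b N)"
proof unfold_locales
  show "line_extension T b N \<subseteq> carrier R"
    using b by (auto simp: line_extension_mem_iff)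
  show "\<zero> \<in> line_extension T b N"
    using line_extension_superset(1)[OF b] by auto
next
  fix x y assume "x \<in> line_extension T b N" "y \<in> line_extension T b N"
  then obtain s t u v where repr: "s \<in> T" "t \<in> T" "u \<in> N" "v \<in> N" "x = s \<otimes> b \<oplus> u" "y = t \<otimes> b \<oplus> v"
    unfolding line_extension_mem_iff by blast
  then have "x \<oplus> y = (s \<oplus> t) \<otimes> b \<oplus> (u \<oplus> v)" using b by algebra
  then show "x \<oplus> y \<in> line_extension T b N" using repr mem_line_extension by simp
next
  fix t x assume "t \<in> T" "x \<in> line_extension T b N"
  then obtain s u where repr: "t \<in> T" "s \<in> T" "u \<in> N" "x = s \<otimes> b \<oplus> u"
    unfolding line_extension_mem_iff by blast
  then have "t \<otimes> x = (t \<otimes> s) \<otimes> b \<oplus> t \<otimes> u" using b by algebra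
  then show "t \<otimes> x \<in> line_extension T b N" using repr mem_line_extension by simp
qed

lemma line_extension_least: "\<lbrakk>b \<in> N; N' \<subseteq> N\<rbrakk> \<Longrightarrow> line_extension T b N' \<subseteq> N"
  by (auto simp: line_extension_mem_iff subset_iff)

lemma Span_least: "set us \<subseteq> N \<Longrightarrow> Span T us \<subseteq> N"
  by (induct us) (auto simp: line_extension_mem_iff subset_iff)

lemma vimage_module:
  assumes k: "k \<in> carrier R"
  shows "subring_module R T {x \<in> carrier R. k \<otimes> x \<in> N}"
proof unfold_locales
  fix t x assume "t \<in> T" "x \<in> {x \<in> carrier R. k \<otimes> x \<in> N}"
  moreover from this have "k \<otimes> (t \<otimes> x) = t \<otimes> (k \<otimes> x)" using k by (simp add: m_lcomm)
  ultimately show "t \<otimes> x \<in> {x \<in> carrier R. k \<otimes> x \<in> N}" by simp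
qed (use k in \<open>auto simp: r_distr\<close>)

end

context cring_subring
begin

lemma Span_module:
  assumes "set us \<subseteq> carrier R"
  shows "subring_module R U (Span U us)"
  using assms
proof (induct us)
  case Nil
  show ?case unfolding Span_simps by unfold_locales auto
next
  case (Cons u us)
  then show ?case using subring_module.line_extension_module[of R U] by simp
qed

lemma set_subset_Span: "set us \<subseteq> carrier R \<Longrightarrow> set us \<subseteq> Span U us"
proof (induct us)
  case (Cons u us)
  then interpret Span: subring_module R U "Span U us" by (intro Span_module) simp
  show ?case using Cons Span.line_extension_superset[of u] by auto
qed simp

end

text \<open>Ideals of a subring are described with the operations of the ambient ring, so that ideals of
  nested subrings can be compared without changing the structure; see \<open>ideal_iff\<close>.\<close>

locale subring_ideal = subring_module R U I for R (structure) and U and I +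
  assumes subset: "I \<subseteq> U"
begin

lemma mem_subring [simp]: "x \<in> I \<Longrightarrow> x \<in> U"
  using subset by blast

lemma eq_subring: "\<one> \<in> I \<Longrightarrow> I = U"
  using subset smult_mem[of _ \<one>] by fastforce

end

locale subring_primeideal = subring_ideal R U Q for R (structure) and U and Q +
  assumes one_notin [simp]: "\<one> \<notin> Q"
    and prime: "\<lbrakk>a \<in> U; b \<in> U; a \<otimes> b \<in> Q\<rbrakk> \<Longrightarrow> a \<in> Q \<or> b \<in> Q"
begin

lemma pow_mem_imp_mem: "\<lbrakk>a \<in> U; a [^] (n::nat) \<in> Q\<rbrakk> \<Longrightarrow> a \<in> Q"
proof (induct n)
  case (Suc n)
  then show ?case using prime[of "a [^] n" a] by auto
qed simp

end

locale subring_maximalideal = subring_ideal R U M for R (structure) and U and M +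
  assumes one_notin: "\<one> \<notin> M"
    and ex_inverse: "\<lbrakk>u \<in> U; u \<notin> M\<rbrakk> \<Longrightarrow> \<exists>v\<in>U. \<one> \<ominus> u \<otimes> v \<in> M"

sublocale subring_maximalideal \<subseteq> subring_primeideal R U M
proof unfold_locales
  fix a b assume ab: "a \<in> U" "b \<in> U" "a \<otimes> b \<in> M"
  have "b \<in> M" if a: "a \<notin> M"
  proof -
    obtain v where v: "v \<in> U" "\<one> \<ominus> a \<otimes> v \<in> M" using ex_inverse[OF ab(1) a] ..
    have "b = b \<otimes> (\<one> \<ominus> a \<otimes> v) \<oplus> v \<otimes> (a \<otimes> b)" using ab(1,2) v(1) by algebra
    also have "\<dots> \<in> M" using ab v by simp
    finally show ?thesis .
  qed
  then show "a \<in> M \<or> b \<in> M" by blast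
qed (rule one_notin)

context cring_subring
begin

lemma ideal_iff: "ideal I (sub_ring R U) \<longleftrightarrow> subring_ideal R U I"
proof
  assume "ideal I (sub_ring R U)"
  then interpret I: ideal I "sub_ring R U" .
  show "subring_ideal R U I"
    using I.I_l_closed additive_subgroup.a_closed[OF I.is_additive_subgroup]
      additive_subgroup.zero_closed[OF I.is_additive_subgroup] I.a_subset
    by unfold_locales auto
next
  assume "subring_ideal R U I"
  then interpret I: subring_ideal R U I .
  interpret sub: cring "sub_ring R U" by (rule is_cring_subring)
  show "ideal I (sub_ring R U)"
  proof (rule idealI)
    show "subgroup I (add_monoid (sub_ring R U))"
    proof (rule sub.add.subgroupI)
      show "\<ominus>\<^bsub>sub_ring R U\<^esub> a \<in> I" if "a \<in> I" for a
        using that by (simp add: a_inv_subring)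
      show "I \<noteq> {}" using I.zero_mem by blast
    qed (use I.subset in auto)
  qed (use sub.ring_axioms in auto)
qed

lemma primeideal_iff: "primeideal Q (sub_ring R U) \<longleftrightarrow> subring_primeideal R U Q"
proof -
  have "Q = U" if "subring_ideal R U Q" "\<one> \<in> Q"
    using subring_ideal.eq_subring[OF that] .
  then show ?thesis
    unfolding primeideal_def primeideal_axioms_def ideal_iff subring_primeideal_def
      subring_primeideal_axioms_def
    using is_cring_subring by auto
qed

lemma subring_module_self: "subring_module R U U"
  by unfold_locales auto

lemma zero_ideal: "subring_ideal R U {\<zero>}"
  by unfold_locales auto

lemma line_extension_ideal:
  assumes "subring_ideal R U I" "a \<in> U"
  shows "subring_ideal R U (line_extension U a I)"
proof -
  interpret I: subring_ideal R U I by fact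
  interpret self: subring_module R U U by (rule subring_module_self)
  show ?thesis
    using I.line_extension_module self.line_extension_least[OF assms(2) I.subset] assms(2)
    by (intro subring_ideal.intro subring_ideal_axioms.intro) simp_all
qed

end

lemma (in subring_maximalideal) maximalideal: "maximalideal M (sub_ring R U)"
proof (rule maximalidealI)
  show "ideal M (sub_ring R U)" unfolding T.ideal_iff by (rule subring_ideal_axioms)
  have "U \<noteq> M" using one_notin T.one_mem by blast
  then show "carrier (sub_ring R U) \<noteq> M" by simp
next
  fix J assume J: "ideal J (sub_ring R U)" "M \<subseteq> J"
  interpret J: subring_ideal R U J using J(1) unfolding T.ideal_iff .
  have "J = U" if "\<not> J \<subseteq> M"
  proof -
    obtain u where u: "u \<in> J" "u \<notin> M" using \<open>\<not> J \<subseteq> M\<close> by blast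
    then obtain v where v: "v \<in> U" "\<one> \<ominus> u \<otimes> v \<in> M" using ex_inverse[of u] by auto
    have "\<one> = (\<one> \<ominus> u \<otimes> v) \<oplus> u \<otimes> v" using u v(1) by algebra
    also have "\<dots> \<in> J" using u(1) v J(2) by auto
    finally show ?thesis by (rule J.eq_subring)
  qed
  then show "J = M \<or> J = carrier (sub_ring R U)" using J(2) by auto
qed

context cring_subring
begin

lemma ex_maximal_disjoint_ideal:
  assumes I: "subring_ideal R U I" "I \<inter> W = {}"
  obtains Q where "subring_ideal R U Q" "I \<subseteq> Q" "Q \<inter> W = {}"
    "\<forall>J. subring_ideal R U J \<longrightarrow> Q \<subset> J \<longrightarrow> J \<inter> W \<noteq> {}"
proof -
  interpret sub: cring "sub_ring R U" by (rule is_cring_subring)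
  define F where "F = {J. subring_ideal R U J \<and> I \<subseteq> J \<and> J \<inter> W = {}}"
  have "\<exists>Q\<in>F. \<forall>J\<in>F. Q \<subseteq> J \<longrightarrow> J = Q"
  proof (rule subset_Zorn_nonempty)
    show "F \<noteq> {}" using I unfolding F_def by blast
    fix C assume C: "C \<noteq> {}" "subset.chain F C"
    then have "subset.chain {J. ideal J (sub_ring R U)} C"
      unfolding subset_chain_def F_def ideal_iff by blast
    then have "subring_ideal R U (\<Union>C)"
      using sub.chain_Union_is_ideal[of C] C(1) unfolding ideal_iff by simp
    moreover have "I \<subseteq> \<Union>C" "\<Union>C \<inter> W = {}"
      using C unfolding subset_chain_def F_def by blast+
    ultimately show "\<Union>C \<in> F" unfolding F_def by blast
  qed
  then obtain Q where Q: "Q \<in> F" and max: "\<And>J. \<lbrakk>J \<in> F; Q \<subseteq> J\<rbrakk> \<Longrightarrow> J = Q" by blast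
  have "\<forall>J. subring_ideal R U J \<longrightarrow> Q \<subset> J \<longrightarrow> J \<inter> W \<noteq> {}"
    using max Q unfolding F_def by blast
  then show thesis using that Q unfolding F_def by blast
qed

lemma maximal_disjoint_imp_primeideal:
  assumes Q: "subring_ideal R U Q" "Q \<inter> W = {}"
    and W: "\<one> \<in> W" "\<And>v w. \<lbrakk>v \<in> W; w \<in> W\<rbrakk> \<Longrightarrow> v \<otimes> w \<in> W"
    and max: "\<forall>J. subring_ideal R U J \<longrightarrow> Q \<subset> J \<longrightarrow> J \<inter> W \<noteq> {}"
  shows "subring_primeideal R U Q"
proof -
  interpret Q: subring_ideal R U Q by fact
  have meets: "\<exists>r\<in>U. \<exists>q\<in>Q. r \<otimes> a \<oplus> q \<in> W" if a: "a \<in> U" "a \<notin> Q" for a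
  proof -
    have "Q \<subset> line_extension U a Q" using Q.line_extension_superset[of a] a by auto
    then have "line_extension U a Q \<inter> W \<noteq> {}"
      using max line_extension_ideal[OF Q(1) a(1)] by blast
    then show ?thesis by (auto simp: line_extension_mem_iff)
  qed
  show ?thesis
  proof unfold_locales
    show "\<one> \<notin> Q" using Q(2) W(1) by blast
  next
    fix a b assume ab: "a \<in> U" "b \<in> U" "a \<otimes> b \<in> Q"
    show "a \<in> Q \<or> b \<in> Q"
    proof (rule ccontr)
      assume "\<not> (a \<in> Q \<or> b \<in> Q)"
      then obtain r p s q where combination: "r \<in> U" "p \<in> Q" "s \<in> U" "q \<in> Q"
        "r \<otimes> a \<oplus> p \<in> W" "s \<otimes> b \<oplus> q \<in> W"
        using meets ab(1,2) by metis
      have "(r \<otimes> a \<oplus> p) \<otimes> (s \<otimes> b \<oplus> q) = (r \<otimes> s) \<otimes> (a \<otimes> b) \<oplus> (r \<otimes> a) \<otimes> q \<oplus> p \<otimes> (s \<otimes> b \<oplus> q)"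
        using ab(1,2) combination(1-4) by algebra
      also have "\<dots> \<in> Q" using ab combination(1-4) by simp
      finally show False using W(2)[OF combination(5,6)] Q(2) by blast
    qed
  qed
qed

lemma ex_primeideal_superset:
  assumes I: "subring_ideal R U I" "\<one> \<notin> I"
  shows "\<exists>Q. subring_primeideal R U Q \<and> I \<subseteq> Q"
proof -
  have disj: "I \<inter> {\<one>} = {}" using I(2) by blast
  obtain Q where Q: "subring_ideal R U Q" "I \<subseteq> Q" "Q \<inter> {\<one>} = {}"
    "\<forall>J. subring_ideal R U J \<longrightarrow> Q \<subset> J \<longrightarrow> J \<inter> {\<one>} \<noteq> {}"
    using ex_maximal_disjoint_ideal[OF I(1) disj] .
  have "subring_primeideal R U Q"
    by (intro maximal_disjoint_imp_primeideal[OF Q(1,3) _ _ Q(4)]) simp_all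
  then show ?thesis using Q(2) by blast
qed

end

subsection \<open>Integral extensions and lying over\<close>

locale ring_extension = cring R + T: cring_subring R T + U: cring_subring R U
  for R (structure) and T and U +
  assumes subset: "T \<subseteq> U"
begin

lemma mem_overring [simp]: "x \<in> T \<Longrightarrow> x \<in> U"
  using subset by blast

lemma overring_module: "subring_module R T U"
  by unfold_locales auto

lemma subring_primeideal_Int:
  assumes "subring_primeideal R U Q"
  shows "subring_primeideal R T (Q \<inter> T)"
proof -
  interpret Q: subring_primeideal R U Q by fact
  show ?thesis using Q.prime by unfold_locales auto
qed

lemma i_extension_iff:
  "i_extension R T U \<longleftrightarrow> (\<forall>P Q. subring_primeideal R U P \<longrightarrow> subring_primeideal R U Q \<longrightarrow>
     P \<inter> T = Q \<inter> T \<longrightarrow> P = Q)"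
  unfolding i_extension_def inj_on_def Spec_def U.primeideal_iff by blast

end

lemma (in ring) mem_set_add: "x \<in> A <+>\<^bsub>R\<^esub> B \<longleftrightarrow> (\<exists>a\<in>A. \<exists>b\<in>B. x = a \<oplus> b)"
  unfolding set_add_def' by blast

lemma (in cring) ring_extensionI: "\<lbrakk>subring T R; subring U R; T \<subseteq> U\<rbrakk> \<Longrightarrow> ring_extension R T U"
  by (simp add: ring_extension_def ring_extension_axioms_def cring_subringI is_cring)

lemma integral_extension_mono:
  assumes "integral_extension R T U" "T \<subseteq> T'" "U' \<subseteq> U"
  shows "integral_extension R T' U'"
proof -
  have "carrier (univ_poly R T) \<subseteq> carrier (univ_poly R T')"
    using subset_trans[OF _ assms(2)] by (auto simp: univ_poly_def polynomial_def)
  then show ?thesis using assms unfolding integral_extension_def by blast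
qed

lemma intermediate_ringI: "\<lbrakk>subring B R; T \<subseteq> B; B \<subseteq> U\<rbrakk> \<Longrightarrow> B \<in> intermediate_rings R T U"
  unfolding intermediate_rings_def by blast

context ring_extension
begin

lemma subring_intermediate: "T \<in> intermediate_rings R T U"
  using T.is_subring subset by (simp add: intermediate_ringI)

lemma intermediate_ring_extension:
  assumes "B \<in> intermediate_rings R T U"
  shows "ring_extension R T B" "ring_extension R B U"
  using assms T.is_subring U.is_subring unfolding intermediate_rings_def
  by (simp_all add: ring_extensionI)

lemma integral_equation:
  assumes "integral_extension R T U" "x \<in> U"
  obtains cs where "set cs \<subseteq> T" "x [^] length cs \<oplus> eval cs x = \<zero>"
proof -
  obtain p where p: "p \<in> carrier (univ_poly R T)" "p \<noteq> []" "lead_coeff p = \<one>" "eval p x = \<zero>"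
    using assms unfolding integral_extension_def by blast
  then obtain cs where cs: "p = \<one> # cs" by (cases p) auto
  then have "set cs \<subseteq> T"
    using p(1) unfolding univ_poly_carrier[symmetric] polynomial_def by auto
  moreover have "x [^] length cs \<oplus> eval cs x = \<zero>" using p(4) cs assms(2) by simp
  ultimately show thesis by (rule that)
qed

lemma add_ideal:
  assumes "subring_ideal R U Q"
  shows "subring (T <+>\<^bsub>R\<^esub> Q) R" "T \<subseteq> T <+>\<^bsub>R\<^esub> Q" "Q \<subseteq> T <+>\<^bsub>R\<^esub> Q" "T <+>\<^bsub>R\<^esub> Q \<subseteq> U"
proof -
  interpret Q: subring_ideal R U Q by fact
  show superset: "T \<subseteq> T <+>\<^bsub>R\<^esub> Q"
  proof
    fix t assume "t \<in> T"
    then show "t \<in> T <+>\<^bsub>R\<^esub> Q" unfolding mem_set_add by (intro bexI[of _ t] bexI[of _ \<zero>]) simp_all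
  qed
  show "Q \<subseteq> T <+>\<^bsub>R\<^esub> Q"
  proof
    fix q assume "q \<in> Q"
    then show "q \<in> T <+>\<^bsub>R\<^esub> Q" unfolding mem_set_add by (intro bexI[of _ \<zero>] bexI[of _ q]) simp_all
  qed
  show "T <+>\<^bsub>R\<^esub> Q \<subseteq> U" by (auto simp: mem_set_add)
  show "subring (T <+>\<^bsub>R\<^esub> Q) R"
  proof (rule subringI)
    show "T <+>\<^bsub>R\<^esub> Q \<subseteq> carrier R" by (auto simp: mem_set_add)
    show "\<one> \<in> T <+>\<^bsub>R\<^esub> Q" using superset by auto
  next
    fix x assume "x \<in> T <+>\<^bsub>R\<^esub> Q"
    then obtain t q where repr: "t \<in> T" "q \<in> Q" "x = t \<oplus> q" unfolding mem_set_add by blast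
    then have "\<ominus> x = \<ominus> t \<oplus> \<ominus> q" by algebra
    then show "\<ominus> x \<in> T <+>\<^bsub>R\<^esub> Q" unfolding mem_set_add using repr T.neg_mem Q.neg_mem by blast
  next
    fix x y assume "x \<in> T <+>\<^bsub>R\<^esub> Q" "y \<in> T <+>\<^bsub>R\<^esub> Q"
    then obtain s p t q where repr: "s \<in> T" "p \<in> Q" "x = s \<oplus> p" "t \<in> T" "q \<in> Q" "y = t \<oplus> q"
      unfolding mem_set_add by blast
    then have "x \<oplus> y = (s \<oplus> t) \<oplus> (p \<oplus> q)" by algebra
    then show "x \<oplus> y \<in> T <+>\<^bsub>R\<^esub> Q" unfolding mem_set_add using repr T.add_mem Q.add_mem by blast
    have "x \<otimes> y = s \<otimes> t \<oplus> (s \<otimes> q \<oplus> p \<otimes> y)" using repr by algebra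
    moreover have "s \<otimes> q \<oplus> p \<otimes> y \<in> Q" using repr by simp
    ultimately show "x \<otimes> y \<in> T <+>\<^bsub>R\<^esub> Q" unfolding mem_set_add using repr T.mult_mem by blast
  qed
qed

text \<open>Scaling by \<open>p\<^sup>n\<close> turns an equation of degree \<open>n\<close> for \<open>x\<close> into one for \<open>p x\<close> whose lower
  coefficients are multiples of \<open>p\<close>.\<close>

lemma pow_mult_eval_cong:
  assumes P: "subring_ideal R T P" and Q: "subring_ideal R U Q"
    and p: "p \<in> P" and x: "x \<in> U" and s: "s \<in> T" "p \<otimes> x \<ominus> s \<in> Q"
    and cs: "set cs \<subseteq> T"
  shows "\<exists>a\<in>P. p [^] length cs \<otimes> eval cs x \<ominus> a \<in> Q"
  using cs
proof (induct cs)
  interpret P: subring_ideal R T P by (rule P)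
  interpret Q: subring_ideal R U Q by (rule Q)
  {
    case Nil
    show ?case by (rule bexI[of _ \<zero>]) (simp_all add: a_minus_def)
  next
    case (Cons d cs)
    let ?n = "length cs"
    obtain a where a: "a \<in> P" "p [^] ?n \<otimes> eval cs x \<ominus> a \<in> Q" using Cons by auto
    have closed: "eval cs x \<in> U" "d \<in> T" using Cons.prems x by (auto intro!: U.eval_mem)
    have pow: "(p \<otimes> x) [^] ?n = p [^] ?n \<otimes> x [^] ?n" using p x by (simp add: nat_pow_distrib)
    have "p [^] Suc ?n \<otimes> eval (d # cs) x \<ominus> (p \<otimes> (d \<otimes> s [^] ?n) \<oplus> p \<otimes> a)
        = p \<otimes> d \<otimes> ((p \<otimes> x) [^] ?n \<ominus> s [^] ?n) \<oplus> p \<otimes> (p [^] ?n \<otimes> eval cs x \<ominus> a)"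
      unfolding pow nat_pow_Suc eval.simps list.sel length_Cons diff_Suc_1
      using a(1) closed p x s(1) by algebra
    also have "\<dots> \<in> Q" using a(2) closed p x s Q.pow_cong by simp
    finally have "p [^] length (d # cs) \<otimes> eval (d # cs) x \<ominus> (p \<otimes> (d \<otimes> s [^] ?n) \<oplus> p \<otimes> a) \<in> Q"
      by simp
    moreover have "p \<otimes> (d \<otimes> s [^] ?n) \<oplus> p \<otimes> a \<in> P" using a(1) closed(2) p s(1) by simp
    ultimately show ?case ..
  }
qed

lemma mem_primeideal_if_integral_cong:
  assumes int: "integral_extension R T U"
    and P: "subring_primeideal R T P" and Q: "subring_ideal R U Q" "Q \<inter> T \<subseteq> P"
    and p: "p \<in> P" and x: "x \<in> U" and s: "s \<in> T" "p \<otimes> x \<ominus> s \<in> Q"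
  shows "s \<in> P"
proof -
  interpret P: subring_primeideal R T P by (rule P)
  interpret Q: subring_ideal R U Q by (rule Q)
  obtain cs where cs: "set cs \<subseteq> T" "x [^] length cs \<oplus> eval cs x = \<zero>"
    using integral_equation[OF int x] .
  define n where "n = length cs"
  obtain a where a: "a \<in> P" "p [^] n \<otimes> eval cs x \<ominus> a \<in> Q"
    using pow_mult_eval_cong[OF P.subring_ideal_axioms Q(1) p x s cs(1)] unfolding n_def by blast
  have eval_mem: "eval cs x \<in> U" using cs(1) x by (auto intro!: U.eval_mem)
  have pow: "(p \<otimes> x) [^] n = p [^] n \<otimes> x [^] n" using p x by (simp add: nat_pow_distrib)
  have "s [^] n \<oplus> a = p [^] n \<otimes> (x [^] n \<oplus> eval cs x)
      \<ominus> (((p \<otimes> x) [^] n \<ominus> s [^] n) \<oplus> (p [^] n \<otimes> eval cs x \<ominus> a))"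
    unfolding pow using a(1) eval_mem p x s(1) by algebra
  also have "\<dots> \<in> Q"
    unfolding cs(2)[folded n_def] using a(2) p x s Q.pow_cong by simp
  finally have "s [^] n \<oplus> a \<in> Q" .
  moreover have "s [^] n \<oplus> a \<in> T" using a(1) s(1) by simp
  ultimately have "s [^] n \<oplus> a \<in> P" using Q(2) by blast
  then have "(s [^] n \<oplus> a) \<ominus> a \<in> P" using a(1) by simp
  moreover have "(s [^] n \<oplus> a) \<ominus> a = s [^] n" using a(1) s(1) by algebra
  ultimately show ?thesis using P.pow_mem_imp_mem[OF s(1), of n] by simp
qed

theorem lying_over:
  assumes int: "integral_extension R T U" and P: "subring_primeideal R T P"
  obtains Q where "subring_primeideal R U Q" "Q \<inter> T = P"
proof -
  interpret P: subring_primeideal R T P by (rule P)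
  have disj: "{\<zero>} \<inter> (T - P) = {}" by simp
  obtain Q where Q: "subring_ideal R U Q" "{\<zero>} \<subseteq> Q" "Q \<inter> (T - P) = {}"
    and max: "\<forall>J. subring_ideal R U J \<longrightarrow> Q \<subset> J \<longrightarrow> J \<inter> (T - P) \<noteq> {}"
    using U.ex_maximal_disjoint_ideal[OF U.zero_ideal disj] .
  interpret Q: subring_ideal R U Q by (rule Q)
  have QP: "Q \<inter> T \<subseteq> P" using Q(3) by blast
  have "p \<in> Q" if p: "p \<in> P" for p
  proof (rule ccontr)
    assume "p \<notin> Q"
    then have "Q \<subset> line_extension U p Q" using Q.line_extension_superset[of p] p by auto
    then have "line_extension U p Q \<inter> (T - P) \<noteq> {}"
      using max U.line_extension_ideal[OF Q(1), of p] p by simp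
    then obtain x q where xq: "x \<in> U" "q \<in> Q" "x \<otimes> p \<oplus> q \<in> T" "x \<otimes> p \<oplus> q \<notin> P"
      by (auto simp: line_extension_mem_iff)
    have "p \<otimes> x \<ominus> (x \<otimes> p \<oplus> q) = \<ominus> q" using xq(1,2) p by algebra
    then have "p \<otimes> x \<ominus> (x \<otimes> p \<oplus> q) \<in> Q" using xq(2) by simp
    then show False
      using mem_primeideal_if_integral_cong[OF int P Q(1) QP p xq(1,3)] xq(4) by blast
  qed
  then have "Q \<inter> T = P" using QP P.subset by blast
  moreover have "subring_primeideal R U Q"
    using P.prime by (intro U.maximal_disjoint_imp_primeideal[OF Q(1,3) _ _ max]) auto
  ultimately show thesis using that[of Q] by simp
qed

lemma i_extension_intermediate:
  assumes B: "B \<in> intermediate_rings R T U" and C: "C \<in> intermediate_rings R T U" "B \<subseteq> C"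
    and int: "integral_extension R T U" and i: "i_extension R T U"
  shows "i_extension R B C"
proof -
  interpret CU: ring_extension R C U using C(1) by (rule intermediate_ring_extension)
  interpret BC: ring_extension R B C
    using B C unfolding intermediate_rings_def by (intro ring_extensionI) auto
  have int': "integral_extension R C U"
    using integral_extension_mono[OF int] C unfolding intermediate_rings_def by blast
  show ?thesis
    unfolding BC.i_extension_iff
  proof (intro allI impI)
    fix P Q assume P: "subring_primeideal R C P" and Q: "subring_primeideal R C Q"
      and eq: "P \<inter> B = Q \<inter> B"
    obtain P' where P': "subring_primeideal R U P'" "P' \<inter> C = P" using CU.lying_over[OF int' P] .
    obtain Q' where Q': "subring_primeideal R U Q'" "Q' \<inter> C = Q" using CU.lying_over[OF int' Q] .
    have "P' \<inter> T = Q' \<inter> T"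
      using eq P'(2) Q'(2) B C(2) unfolding intermediate_rings_def by blast
    then have "P' = Q'" using i P'(1) Q'(1) unfolding i_extension_iff by blast
    then show "P = Q" using P'(2) Q'(2) by simp
  qed
qed

end

subsection \<open>Conductors\<close>

context ring_extension
begin

lemma mem_conductor_iff: "x \<in> conductor R T U \<longleftrightarrow> x \<in> U \<and> (\<forall>u\<in>U. x \<otimes> u \<in> T)"
  unfolding conductor_def by simp

lemma conductor_subset: "conductor R T U \<subseteq> T"
proof
  fix x assume x: "x \<in> conductor R T U"
  then have "x \<otimes> \<one> \<in> T" using U.one_mem unfolding mem_conductor_iff by blast
  then show "x \<in> T" using x unfolding mem_conductor_iff by simp
qed

lemma colon_ideal:
  assumes "subring_ideal R U I"
  shows "subring_ideal R U {x \<in> U. \<forall>y\<in>I. x \<otimes> y \<in> T}"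
proof -
  interpret I: subring_ideal R U I by fact
  show ?thesis
  proof unfold_locales
    fix u x assume mem: "u \<in> U" "x \<in> {x \<in> U. \<forall>y\<in>I. x \<otimes> y \<in> T}"
    then have "u \<otimes> x \<otimes> y = x \<otimes> (u \<otimes> y)" if "y \<in> I" for y using that by (simp add: m_ac)
    then show "u \<otimes> x \<in> {x \<in> U. \<forall>y\<in>I. x \<otimes> y \<in> T}" using mem by simp
  qed (auto simp: l_distr)
qed

sublocale conductor: subring_ideal R U "conductor R T U"
proof -
  have "subring_ideal R U U" by unfold_locales auto
  then show "subring_ideal R U (conductor R T U)"
    unfolding conductor_def by (rule colon_ideal)
qed

lemma colon_mult_mem_conductor:
  assumes I: "subring_ideal R U I" and u: "u \<in> {x \<in> U. \<forall>y\<in>I. x \<otimes> y \<in> T}" and v: "v \<in> I"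
  shows "u \<otimes> v \<in> conductor R T U"
  unfolding mem_conductor_iff
proof (intro conjI ballI)
  interpret I: subring_ideal R U I by (rule I)
  show "u \<otimes> v \<in> U" using u v by simp
  fix w assume "w \<in> U"
  moreover from this have "v \<otimes> w \<in> I" using v by simp
  ultimately show "u \<otimes> v \<otimes> w \<in> T" using u v I.mem_subring by (simp add: m_assoc)
qed

lemma conductor_ideal_subring: "subring_ideal R T (conductor R T U)"
  using conductor_subset by unfold_locales auto

end

subsection \<open>Adjoining a root of a quadratic polynomial\<close>

locale quadratic_extension = cring R + T: cring_subring R T
  for R (structure) and T and b and p and q +
  assumes b: "b \<in> carrier R" and p [simp]: "p \<in> T" and q [simp]: "q \<in> T"
    and b_square: "b \<otimes> b = q \<otimes> b \<oplus> p"
begin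

abbreviation T_b :: "'a set" where
  "T_b \<equiv> line_extension T b T"

lemma mult_line_extension:
  assumes "s \<in> T" "x \<in> T" "t \<in> T" "y \<in> T"
  shows "(s \<otimes> b \<oplus> x) \<otimes> (t \<otimes> b \<oplus> y)
    = (s \<otimes> t \<otimes> q \<oplus> s \<otimes> y \<oplus> x \<otimes> t) \<otimes> b \<oplus> (s \<otimes> t \<otimes> p \<oplus> x \<otimes> y)"
proof -
  have "(s \<otimes> b \<oplus> x) \<otimes> (t \<otimes> b \<oplus> y) = s \<otimes> t \<otimes> (b \<otimes> b) \<oplus> (s \<otimes> y \<oplus> x \<otimes> t) \<otimes> b \<oplus> x \<otimes> y"
    using assms b by algebra
  also have "\<dots> = (s \<otimes> t \<otimes> q \<oplus> s \<otimes> y \<oplus> x \<otimes> t) \<otimes> b \<oplus> (s \<otimes> t \<otimes> p \<oplus> x \<otimes> y)"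
    unfolding b_square using assms b p q by algebra
  finally show ?thesis .
qed

sublocale T_b: subring_module R T T_b
  using subring_module.line_extension_module[OF T.subring_module_self b] .

lemma subring_line_extension: "subring T_b R"
proof (rule subringI)
  show "\<one> \<in> T_b"
    using subring_module.line_extension_superset(1)[OF T.subring_module_self b] by auto
next
  fix u v assume "u \<in> T_b" "v \<in> T_b"
  then obtain s x t y where repr: "s \<in> T" "x \<in> T" "u = s \<otimes> b \<oplus> x" "t \<in> T" "y \<in> T" "v = t \<otimes> b \<oplus> y"
    unfolding line_extension_mem_iff by blast
  then show "u \<otimes> v \<in> T_b"
    unfolding repr(3,6) mult_line_extension[OF repr(1,2,4,5)]
    by (intro subring_module.mem_line_extension[OF T.subring_module_self]) simp_all
qed (simp_all add: T_b.subset_carrier)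

sublocale T_b: ring_extension R T T_b
  using subring_line_extension T.is_subring
    subring_module.line_extension_superset(1)[OF T.subring_module_self b]
  by (intro ring_extensionI)

lemma b_mem [simp]: "b \<in> T_b"
  using subring_module.line_extension_superset(2)[OF T.subring_module_self b] .

lemma mem_conductor:
  assumes r: "r \<in> T" "r \<otimes> b \<in> T"
  shows "r \<in> conductor R T T_b"
  unfolding T_b.mem_conductor_iff
proof (intro conjI ballI)
  fix u assume "u \<in> T_b"
  then obtain t x where repr: "t \<in> T" "x \<in> T" "u = t \<otimes> b \<oplus> x"
    unfolding line_extension_mem_iff by blast
  have "r \<otimes> u = t \<otimes> (r \<otimes> b) \<oplus> r \<otimes> x" unfolding repr(3) using repr r(1) b by algebra
  then show "r \<otimes> u \<in> T" using repr r by simp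
qed (use r in simp)

text \<open>If \<open>M\<close> contains \<open>p\<close> and the conductor, then modulo \<open>M\<close> the polynomial is \<open>X (X - q)\<close> and \<open>b\<close> is
  free over \<open>T\<close>, so \<open>b \<mapsto> 0\<close> is a well-defined specialization.\<close>

lemma mem_line_extension_iff:
  assumes M: "subring_primeideal R T M" "conductor R T T_b \<subseteq> M" and t: "t \<in> T" and x: "x \<in> T"
  shows "t \<otimes> b \<oplus> x \<in> line_extension T b M \<longleftrightarrow> x \<in> M"
proof
  interpret M: subring_primeideal R T M by (rule M)
  assume "t \<otimes> b \<oplus> x \<in> line_extension T b M"
  then obtain s m where repr: "s \<in> T" "m \<in> M" "t \<otimes> b \<oplus> x = s \<otimes> b \<oplus> m"
    unfolding line_extension_mem_iff by blast
  have "(s \<ominus> t) \<otimes> b = (s \<otimes> b \<oplus> m) \<ominus> m \<ominus> t \<otimes> b" using repr(1,2) t b by algebra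
  also have "\<dots> = x \<ominus> m" unfolding repr(3)[symmetric] using repr(2) t x b by algebra
  finally have eq: "(s \<ominus> t) \<otimes> b = x \<ominus> m" .
  then have "s \<ominus> t \<in> conductor R T T_b" using mem_conductor repr t x by simp
  then have "(s \<ominus> t) \<otimes> b \<in> conductor R T T_b"
    by simp
  then have "(s \<ominus> t) \<otimes> b \<oplus> m \<in> M" using M(2) repr(2) by auto
  moreover have "(s \<ominus> t) \<otimes> b \<oplus> m = x" unfolding eq using repr(2) x by algebra
  ultimately show "x \<in> M" by simp
qed (use t in \<open>auto simp: line_extension_mem_iff\<close>)

lemma mult_mem_line_extension_iff:
  assumes M: "subring_primeideal R T M" "conductor R T T_b \<subseteq> M" and pM: "p \<in> M"
    and mem: "s \<in> T" "x \<in> T" "t \<in> T" "y \<in> T"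
  shows "(s \<otimes> b \<oplus> x) \<otimes> (t \<otimes> b \<oplus> y) \<in> line_extension T b M \<longleftrightarrow> x \<otimes> y \<in> M"
proof -
  interpret M: subring_primeideal R T M by (rule M)
  have "s \<otimes> t \<otimes> p \<oplus> x \<otimes> y \<in> M \<longleftrightarrow> x \<otimes> y \<in> M"
  proof
    assume "s \<otimes> t \<otimes> p \<oplus> x \<otimes> y \<in> M"
    then have "(s \<otimes> t \<otimes> p \<oplus> x \<otimes> y) \<ominus> s \<otimes> t \<otimes> p \<in> M" using mem pM by simp
    moreover have "(s \<otimes> t \<otimes> p \<oplus> x \<otimes> y) \<ominus> s \<otimes> t \<otimes> p = x \<otimes> y" using mem p by algebra
    ultimately show "x \<otimes> y \<in> M" by simp
  qed (use mem pM in simp)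
  then show ?thesis
    unfolding mult_line_extension[OF mem] using mem_line_extension_iff[OF M] mem by simp
qed

lemma primeideal_line_extension:
  assumes M: "subring_primeideal R T M" "conductor R T T_b \<subseteq> M" and pM: "p \<in> M"
  shows "subring_primeideal R T_b (line_extension T b M)" "line_extension T b M \<inter> T = M"
proof -
  interpret M: subring_primeideal R T M by (rule M)
  interpret Q: subring_module R T "line_extension T b M" using b by (rule M.line_extension_module)
  note mem_iff = mem_line_extension_iff[OF M]
  have memT: "x \<in> line_extension T b M \<longleftrightarrow> x \<in> M" if "x \<in> T" for x
    using mem_iff[OF T.zero_mem that] that b by simp
  then show "line_extension T b M \<inter> T = M" by auto
  note mult_mem_iff = mult_mem_line_extension_iff[OF M pM]
  show "subring_primeideal R T_b (line_extension T b M)"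
  proof unfold_locales
    show "line_extension T b M \<subseteq> T_b"
      using T_b.line_extension_least[OF b_mem] M.subset T_b.subset by blast
    show "\<one> \<notin> line_extension T b M" using memT by simp
  next
    fix u v assume "u \<in> T_b" "v \<in> line_extension T b M"
    then show "u \<otimes> v \<in> line_extension T b M"
      unfolding line_extension_mem_iff[of u] line_extension_mem_iff[of v] using mult_mem_iff by auto
  next
    fix u v assume uv: "u \<in> T_b" "v \<in> T_b" "u \<otimes> v \<in> line_extension T b M"
    then obtain s x t y where repr: "s \<in> T" "x \<in> T" "u = s \<otimes> b \<oplus> x" "t \<in> T" "y \<in> T" "v = t \<otimes> b \<oplus> y"
      unfolding line_extension_mem_iff[of _ T b T] by blast
    then have "x \<otimes> y \<in> M" using uv(3) mult_mem_iff by simp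
    then show "u \<in> line_extension T b M \<or> v \<in> line_extension T b M"
      unfolding repr(3,6) using mem_iff M.prime repr by blast
  qed (use Q.subset_carrier in auto)
qed

end

subsection \<open>Minimal integral extensions\<close>

lemma (in subring_module) subring_multipliers: "subring {x \<in> carrier R. \<forall>y\<in>N. x \<otimes> y \<in> N} R"
proof (rule subringI)
  fix x assume x: "x \<in> {x \<in> carrier R. \<forall>y\<in>N. x \<otimes> y \<in> N}"
  then show "\<ominus> x \<in> {x \<in> carrier R. \<forall>y\<in>N. x \<otimes> y \<in> N}" by (simp add: l_minus)
qed (auto simp: l_distr m_assoc)

context cring_subring
begin

lemma Span_powers:
  assumes u: "u \<in> carrier R" and cs: "set cs \<subseteq> U" "u [^] length cs \<oplus> eval cs u = \<zero>"
  defines "L \<equiv> Span U (map (\<lambda>i. u [^] i) [0..<length cs])"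
  shows "\<one> \<in> L" and "x \<in> L \<Longrightarrow> u \<otimes> x \<in> L"
proof -
  define powers where "powers = map (\<lambda>i. u [^] i) [0..<length cs]"
  have powers: "set powers = (\<lambda>i. u [^] i) ` {..<length cs}" unfolding powers_def by auto
  then have carrier: "set powers \<subseteq> carrier R" using u by auto
  interpret L: subring_module R U L
    using Span_module[OF carrier] unfolding L_def powers_def .
  have pow: "u [^] i \<in> L" if "i < length cs" for i
    using that powers set_subset_Span[OF carrier] unfolding L_def powers_def by auto
  have "eval ds u \<in> L" if "set ds \<subseteq> U" "length ds \<le> length cs" for ds
    using that by (induct ds) (simp_all add: pow)
  then have eval: "eval cs u \<in> L" using cs(1) by simp
  then have "u [^] length cs = \<ominus> eval cs u"
    using cs(2) u by (intro minus_equality[symmetric]) simp_all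
  then have top: "u [^] length cs \<in> L" using eval by simp
  show "\<one> \<in> L" using pow[of 0] top by (cases "length cs = 0") simp_all
  have "set powers \<subseteq> {x \<in> carrier R. u \<otimes> x \<in> L}"
  proof
    fix x assume "x \<in> set powers"
    then obtain i where i: "i < length cs" "x = u [^] i" unfolding powers by blast
    have "u \<otimes> x = u [^] Suc i" unfolding i(2) using u by (simp add: m_comm)
    also have "\<dots> \<in> L" using i(1) pow[of "Suc i"] top by (cases "Suc i = length cs") auto
    finally show "x \<in> {x \<in> carrier R. u \<otimes> x \<in> L}" using i(2) u by simp
  qed
  then have "L \<subseteq> {x \<in> carrier R. u \<otimes> x \<in> L}"
    unfolding L_def powers_def[symmetric]
    by (intro subring_module.Span_least
        [OF L.vimage_module[OF u, unfolded L_def powers_def[symmetric]]])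
  then show "u \<otimes> x \<in> L" if "x \<in> L" using that by blast
qed

end

lemma (in subring_module) annihilator_line_extension:
  assumes t: "t \<in> T" and s: "s \<in> T" and E: "E \<subseteq> carrier R"
    and v: "v \<in> carrier R" and y: "y \<in> E" "v \<ominus> t \<otimes> y \<in> N"
    and mult: "\<And>x. x \<in> E \<Longrightarrow> (\<one> \<ominus> t \<otimes> s) \<otimes> x \<in> line_extension T v N"
  shows "\<exists>r\<in>T. \<forall>x\<in>E. (\<one> \<ominus> t \<otimes> r) \<otimes> x \<in> N"
proof -
  have y_carrier: "y \<in> carrier R" using y(1) E by blast
  obtain a n where an: "a \<in> T" "n \<in> N" "(\<one> \<ominus> t \<otimes> s) \<otimes> y = a \<otimes> v \<oplus> n"
    using mult[OF y(1)] unfolding line_extension_mem_iff by blast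
  have "(\<one> \<ominus> t \<otimes> (s \<oplus> a)) \<otimes> v
      = (\<one> \<ominus> t \<otimes> s) \<otimes> (v \<ominus> t \<otimes> y) \<oplus> t \<otimes> ((\<one> \<ominus> t \<otimes> s) \<otimes> y) \<ominus> t \<otimes> (a \<otimes> v)"
    using t s v y_carrier an(1) by algebra
  also have "\<dots> = (\<one> \<ominus> t \<otimes> s) \<otimes> (v \<ominus> t \<otimes> y) \<oplus> t \<otimes> n"
    unfolding an(3) using t s v y_carrier an(1,2) by algebra
  also have "\<dots> \<in> N" using t s y(2) an(2) by simp
  finally have v_mult: "(\<one> \<ominus> t \<otimes> (s \<oplus> a)) \<otimes> v \<in> N" .
  define r where "r = s \<oplus> a \<oplus> s \<ominus> t \<otimes> (s \<oplus> a) \<otimes> s"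
  have "(\<one> \<ominus> t \<otimes> r) \<otimes> x \<in> N" if x: "x \<in> E" for x
  proof -
    have x_carrier: "x \<in> carrier R" using x E by blast
    obtain c m where cm: "c \<in> T" "m \<in> N" "(\<one> \<ominus> t \<otimes> s) \<otimes> x = c \<otimes> v \<oplus> m"
      using mult[OF x] unfolding line_extension_mem_iff by blast
    have "(\<one> \<ominus> t \<otimes> r) \<otimes> x = (\<one> \<ominus> t \<otimes> (s \<oplus> a)) \<otimes> ((\<one> \<ominus> t \<otimes> s) \<otimes> x)"
      unfolding r_def using x_carrier t s an(1) by algebra
    also have "\<dots> = c \<otimes> ((\<one> \<ominus> t \<otimes> (s \<oplus> a)) \<otimes> v) \<oplus> (\<one> \<ominus> t \<otimes> (s \<oplus> a)) \<otimes> m"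
      unfolding cm(3) using t s an(1) cm(1,2) v by algebra
    also have "\<dots> \<in> N" using v_mult t s an(1) cm(1,2) by simp
    finally show ?thesis .
  qed
  then show ?thesis using t s an(1) unfolding r_def by (intro bexI[of _ r, unfolded r_def]) simp_all
qed

text \<open>Induction on the number of generators: replacing \<open>N\<close> by \<open>N + U v\<close> removes the generator \<open>v\<close>.\<close>

lemma (in cring_subring) nakayama:
  assumes "subring_module R U N" and t: "t \<in> U" and E: "set us \<subseteq> E" "E \<subseteq> carrier R"
    and "E \<subseteq> N <+>\<^bsub>R\<^esub> Span U us" and "\<And>x. x \<in> E \<Longrightarrow> \<exists>y\<in>E. x \<ominus> t \<otimes> y \<in> N"
  shows "\<exists>s\<in>U. \<forall>x\<in>E. (\<one> \<ominus> t \<otimes> s) \<otimes> x \<in> N"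
  using assms(1,3,5,6)
proof (induct us arbitrary: N)
  case Nil
  interpret N: subring_module R U N by (rule Nil)
  have "(\<one> \<ominus> t \<otimes> \<zero>) \<otimes> x \<in> N" if "x \<in> E" for x
    using that Nil(3) t by (auto simp: mem_set_add a_minus_def)
  then show ?case using zero_mem by blast
next
  case (Cons v us)
  interpret N: subring_module R U N by (rule Cons)
  have v: "v \<in> E" "v \<in> carrier R" using Cons.prems(2) E(2) by auto
  interpret Span: subring_module R U "Span U us"
    using Cons.prems(2) E(2) by (intro Span_module) auto
  have "E \<subseteq> line_extension U v N <+>\<^bsub>R\<^esub> Span U us"
  proof
    fix x assume "x \<in> E"
    then have "x \<in> N <+>\<^bsub>R\<^esub> line_extension U v (Span U us)" using Cons.prems(3) by auto
    then obtain n a e where repr: "n \<in> N" "a \<in> U" "e \<in> Span U us" "x = n \<oplus> (a \<otimes> v \<oplus> e)"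
      by (auto simp: mem_set_add line_extension_mem_iff)
    then have "x = (a \<otimes> v \<oplus> n) \<oplus> e" using v(2) by algebra
    then show "x \<in> line_extension U v N <+>\<^bsub>R\<^esub> Span U us"
      unfolding mem_set_add using N.mem_line_extension repr by blast
  qed
  moreover have "\<exists>y\<in>E. x \<ominus> t \<otimes> y \<in> line_extension U v N" if "x \<in> E" for x
    using Cons.prems(4) that N.line_extension_superset(1)[OF v(2)] by blast
  ultimately obtain s where "s \<in> U" "\<forall>x\<in>E. (\<one> \<ominus> t \<otimes> s) \<otimes> x \<in> line_extension U v N"
    using Cons.hyps[OF N.line_extension_module[OF v(2)]] Cons.prems(2) by auto
  moreover obtain y where "y \<in> E" "v \<ominus> t \<otimes> y \<in> N" using Cons.prems(4) v(1) by blast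
  ultimately show ?case using N.annihilator_line_extension[OF t _ E(2) v(2)] by blast
qed

locale minimal_ring_extension = ring_extension +
  assumes minimal: "minimal_extension R T U"
begin

lemma proper: "T \<noteq> U"
  using minimal unfolding minimal_extension_def by blast

lemma intermediate_ring_eq: "\<lbrakk>subring B R; T \<subseteq> B; B \<subseteq> U; u \<in> B; u \<notin> T\<rbrakk> \<Longrightarrow> B = U"
  using minimal unfolding minimal_extension_def intermediate_rings_def by blast

end

lemma (in cring) minimal_ring_extensionI:
  assumes "minimal_extension R T U"
  shows "minimal_ring_extension R T U"
proof -
  have "ring_extension R T U"
    using assms unfolding minimal_extension_def intermediate_rings_def
    by (intro ring_extensionI) blast+
  then show ?thesis
    using assms by (simp add: minimal_ring_extension_def minimal_ring_extension_axioms_def)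
qed

locale minimal_integral_extension = minimal_ring_extension +
  assumes integral: "integral_extension R T U"
begin

lemma finite_extension: "finite_extension R T U"
proof -
  obtain u where u: "u \<in> U" "u \<notin> T" using subset proper by blast
  obtain cs where cs: "set cs \<subseteq> T" "u [^] length cs \<oplus> eval cs u = \<zero>"
    using integral_equation[OF integral u(1)] .
  define powers where "powers = map (\<lambda>i. u [^] i) [0..<length cs]"
  have powers: "set powers \<subseteq> U" "set powers \<subseteq> carrier R" unfolding powers_def using u(1) by auto
  interpret L: subring_module R T "Span T powers" using powers(2) by (rule T.Span_module)
  note L = T.Span_powers[OF _ cs, folded powers_def]
  let ?W = "{x \<in> carrier R. \<forall>y\<in>Span T powers. x \<otimes> y \<in> Span T powers} \<inter> U"
  have "?W = U"
  proof (rule intermediate_ring_eq)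
    show "subring ?W R" using L.subring_multipliers U.is_subring by (rule subring_inter)
    show "T \<subseteq> ?W" "u \<in> ?W" using u(1) L(2) by auto
  qed (use u(2) in auto)
  have "x \<in> Span T powers" if "x \<in> U" for x
  proof -
    have "x \<otimes> \<one> \<in> Span T powers" using \<open>?W = U\<close> that L(1) u(1) by blast
    then show ?thesis using that by simp
  qed
  moreover have "Span T powers \<subseteq> U"
    using powers(1) by (rule subring_module.Span_least[OF overring_module])
  ultimately show ?thesis unfolding finite_extension_def using powers(1) by blast
qed

lemma ex_diff_mult_mem:
  assumes t: "t \<in> T" "t \<notin> conductor R T U" and u: "u \<in> U"
  shows "\<exists>x\<in>U. u \<ominus> t \<otimes> x \<in> T"
proof -
  interpret Ut: subring_ideal R U "line_extension U t {\<zero>}"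
    using U.line_extension_ideal[OF U.zero_ideal] t(1) by simp
  note sum = add_ideal[OF Ut.subring_ideal_axioms]
  obtain x where x: "x \<in> U" "t \<otimes> x \<notin> T" using t unfolding mem_conductor_iff by auto
  have "t \<otimes> x = x \<otimes> t \<oplus> \<zero>" using x(1) t(1) by algebra
  then have "t \<otimes> x \<in> line_extension U t {\<zero>}" using x(1) unfolding line_extension_mem_iff by blast
  then have "T <+>\<^bsub>R\<^esub> line_extension U t {\<zero>} = U"
    using intermediate_ring_eq[OF sum(1,2,4)] sum(3) x(2) by blast
  then have "u \<in> T <+>\<^bsub>R\<^esub> line_extension U t {\<zero>}" using u by simp
  then obtain a z where z: "a \<in> T" "z \<in> line_extension U t {\<zero>}" "u = a \<oplus> z"
    unfolding mem_set_add by blast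
  then obtain y where y: "a \<in> T" "y \<in> U" "u = a \<oplus> (y \<otimes> t \<oplus> \<zero>)"
    unfolding line_extension_mem_iff by blast
  then have "u \<ominus> t \<otimes> y = a" using t(1) by algebra
  then show ?thesis using y by blast
qed

lemma conductor_maximalideal: "subring_maximalideal R T (conductor R T U)"
proof -
  interpret M: subring_ideal R T "conductor R T U" by (rule conductor_ideal_subring)
  show ?thesis
  proof unfold_locales
    obtain u where "u \<in> U" "\<one> \<otimes> u \<notin> T" using subset proper by force
    then show "\<one> \<notin> conductor R T U" unfolding mem_conductor_iff by blast
  next
    fix t assume t: "t \<in> T" "t \<notin> conductor R T U"
    obtain us where us: "set us \<subseteq> U" "Span T us = U"
      using finite_extension unfolding finite_extension_def by blast
    have "U \<subseteq> T <+>\<^bsub>R\<^esub> Span T us"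
    proof
      fix u assume "u \<in> U"
      then show "u \<in> T <+>\<^bsub>R\<^esub> Span T us"
        unfolding mem_set_add us(2) by (intro bexI[of _ \<zero>] bexI[of _ u]) simp_all
    qed
    with ex_diff_mult_mem[OF t] us(1) obtain s where s: "s \<in> T" "\<forall>x\<in>U. (\<one> \<ominus> t \<otimes> s) \<otimes> x \<in> T"
      using T.nakayama[OF T.subring_module_self t(1) _ U.subset_carrier] by blast
    have "\<one> \<ominus> t \<otimes> s \<in> U" using t(1) s(1) by simp
    then show "\<exists>s\<in>T. \<one> \<ominus> t \<otimes> s \<in> conductor R T U" using s unfolding mem_conductor_iff by blast
  qed
qed

end

lemma (in cring) minimal_integral_extensionI:
  "\<lbrakk>minimal_extension R T U; integral_extension R T U\<rbrakk> \<Longrightarrow> minimal_integral_extension R T U"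
  by (simp add: minimal_integral_extension_def minimal_integral_extension_axioms_def
      minimal_ring_extensionI)

subsection \<open>The finite chain condition\<close>

lemma FCP_ex_minimal_maximal:
  assumes "FCP A T U" "F \<subseteq> intermediate_rings A T U" "F \<noteq> {}"
  shows "\<exists>B\<in>F. \<forall>C\<in>F. C \<subseteq> B \<longrightarrow> C = B" and "\<exists>B\<in>F. \<forall>C\<in>F. B \<subseteq> C \<longrightarrow> C = B"
proof -
  obtain K where K: "subset.maxchain F K" using subset.Hausdorff by blast
  then have chain: "subset.chain F K" by (rule subset.maxchain_imp_chain)
  then have "subset.chain (intermediate_rings A T U) K"
    using assms(2) unfolding subset_chain_def by blast
  then have "finite K" using assms(1) unfolding FCP_def by blast
  moreover have "K \<noteq> {}"
  proof
    assume "K = {}"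
    moreover obtain B where "B \<in> F" using assms(3) by blast
    then have "subset.chain F {B}" unfolding subset_chain_def by blast
    ultimately show False using K unfolding subset.maxchain_def by blast
  qed
  ultimately have ends: "\<Inter>K \<in> K" "\<Union>K \<in> K"
    using chain Inter_in_chain Union_in_chain by blast+
  have mem: "C \<in> K" if "C \<in> F" "C \<subseteq> \<Inter>K \<or> \<Union>K \<subseteq> C" for C
  proof -
    have "subset.chain F (insert C K)" using chain that unfolding subset_chain_def by blast
    then show ?thesis using K unfolding subset.maxchain_def by blast
  qed
  have "K \<subseteq> F" using chain unfolding subset_chain_def by blast
  then have "\<Inter>K \<in> F" "\<Union>K \<in> F" using ends by blast+
  moreover have "C = \<Inter>K" if "C \<in> F" "C \<subseteq> \<Inter>K" for C
    using mem[of C] that by blast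
  moreover have "C = \<Union>K" if "C \<in> F" "\<Union>K \<subseteq> C" for C
    using mem[of C] that by blast
  ultimately show "\<exists>B\<in>F. \<forall>C\<in>F. C \<subseteq> B \<longrightarrow> C = B" "\<exists>B\<in>F. \<forall>C\<in>F. B \<subseteq> C \<longrightarrow> C = B"
    by meson+
qed

lemma FCP_ex_minimal_extension:
  assumes fcp: "FCP A T U" and B: "B \<in> intermediate_rings A T U" "B \<noteq> U"
    and U: "subring U A"
  obtains C where "C \<in> intermediate_rings A T U" "minimal_extension A B C"
proof -
  let ?F = "{C \<in> intermediate_rings A T U. B \<subset> C}"
  have "U \<in> ?F" using B U unfolding intermediate_rings_def by blast
  then have "?F \<noteq> {}" by blast
  then obtain C where C: "C \<in> ?F" and min: "\<forall>D\<in>?F. D \<subseteq> C \<longrightarrow> D = C"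
    using FCP_ex_minimal_maximal(1)[OF fcp, of ?F] by blast
  have "minimal_extension A B C"
    unfolding minimal_extension_def
  proof (intro conjI subset_antisym)
    show "B \<subset> C" using C by blast
    show "{B, C} \<subseteq> intermediate_rings A B C"
      using B C unfolding intermediate_rings_def by blast
    show "intermediate_rings A B C \<subseteq> {B, C}"
    proof
      fix D assume D: "D \<in> intermediate_rings A B C"
      then have "D \<in> ?F" if "D \<noteq> B"
        using that B C unfolding intermediate_rings_def by blast
      then show "D \<in> {B, C}" using min D unfolding intermediate_rings_def by blast
    qed
  qed
  then show thesis using that C by blast
qed

lemma FCP_induct [consumes 3, case_names top minimal_step]:
  assumes fcp: "FCP A T U" and T: "T \<in> intermediate_rings A T U" and U: "subring U A"
    and top: "P U"
    and step: "\<And>B C. \<lbrakk>B \<in> intermediate_rings A T U; C \<in> intermediate_rings A T U;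
      minimal_extension A B C; P C\<rbrakk> \<Longrightarrow> P B"
  shows "P T"
proof (rule ccontr)
  let ?F = "{B \<in> intermediate_rings A T U. \<not> P B}"
  assume "\<not> P T"
  then have "?F \<noteq> {}" using T by blast
  then obtain B where B: "B \<in> ?F" and max: "\<forall>C\<in>?F. B \<subseteq> C \<longrightarrow> C = B"
    using FCP_ex_minimal_maximal(2)[OF fcp, of ?F] by blast
  moreover from this have "B \<noteq> U" using top by blast
  ultimately obtain C where C: "C \<in> intermediate_rings A T U" "minimal_extension A B C"
    using FCP_ex_minimal_extension[OF fcp _ _ U] by blast
  then have "P C" using max unfolding minimal_extension_def by blast
  then show False using step[OF _ C] B by blast
qed

subsection \<open>Strong \<open>\<pi>\<close>-regularity modulo the conductor\<close>

definition (in ring) strongly_pi_regular_mod :: "'a set \<Rightarrow> 'a set \<Rightarrow> bool" where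
  "strongly_pi_regular_mod U J \<longleftrightarrow> (\<forall>x\<in>U. \<exists>n::nat. \<exists>y\<in>U. x [^] n \<otimes> (\<one> \<ominus> y \<otimes> x) \<in> J)"

context ring_extension
begin

text \<open>Modulo \<open>M\<close>, drop the constant coefficient while it vanishes; otherwise it is invertible and
  the equation exhibits a power of \<open>x\<close> as a multiple of the next one.\<close>

lemma ex_pi_regular_if_eval_mem:
  assumes J: "subring_ideal R U J" and M: "subring_maximalideal R T M" "M \<subseteq> J" and x: "x \<in> U"
    and cs: "set cs \<subseteq> T" "\<not> set cs \<subseteq> M" and mem: "x [^] (n::nat) \<otimes> eval cs x \<in> J"
  shows "\<exists>n::nat. \<exists>y\<in>U. x [^] n \<otimes> (\<one> \<ominus> y \<otimes> x) \<in> J"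
  using cs mem
proof (induct cs arbitrary: n rule: rev_induct)
  case (snoc c cs)
  interpret J: subring_ideal R U J by (rule J)
  interpret M: subring_maximalideal R T M by (rule M)
  have c: "c \<in> T" and cs: "set cs \<subseteq> T" using snoc.prems(1) by auto
  have eval_mem: "eval cs x \<in> U" using cs x subset by (intro U.eval_mem) auto
  have eval_append: "eval (cs @ [c]) x = eval cs x \<otimes> x \<oplus> c"
    using cs c x T.subset_carrier by (intro eval_append_aux) auto
  note mem = snoc.prems(3)[unfolded eval_append]
  show ?case
  proof (cases "c \<in> M")
    case True
    have "x [^] Suc n \<otimes> eval cs x = x [^] n \<otimes> (eval cs x \<otimes> x \<oplus> c) \<ominus> x [^] n \<otimes> c"
      unfolding nat_pow_Suc using c eval_mem x by algebra
    also have "\<dots> \<in> J" using mem x subsetD[OF M(2) True] by simp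
    finally have "x [^] Suc n \<otimes> eval cs x \<in> J" .
    moreover have "\<not> set cs \<subseteq> M" using snoc.prems(2) True by simp
    ultimately show ?thesis using snoc.hyps cs by blast
  next
    case False
    then obtain s where s: "s \<in> T" "\<one> \<ominus> c \<otimes> s \<in> M" using M.ex_inverse c by blast
    have "x [^] n \<otimes> (\<one> \<ominus> (\<ominus> (s \<otimes> eval cs x)) \<otimes> x)
        = s \<otimes> (x [^] n \<otimes> (eval cs x \<otimes> x \<oplus> c)) \<oplus> x [^] n \<otimes> (\<one> \<ominus> c \<otimes> s)"
      using c eval_mem x s(1) by algebra
    also have "\<dots> \<in> J" using mem x s(1) subsetD[OF M(2) s(2)] by simp
    finally have "x [^] n \<otimes> (\<one> \<ominus> (\<ominus> (s \<otimes> eval cs x)) \<otimes> x) \<in> J" .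
    moreover have "\<ominus> (s \<otimes> eval cs x) \<in> U" using s(1) eval_mem by simp
    ultimately show ?thesis by blast
  qed
qed simp

lemma integral_strongly_pi_regular_mod:
  assumes int: "integral_extension R T U" and J: "subring_ideal R U J"
    and M: "subring_maximalideal R T M" "M \<subseteq> J"
  shows "strongly_pi_regular_mod U J"
  unfolding strongly_pi_regular_mod_def
proof
  fix x assume x: "x \<in> U"
  obtain cs where cs: "set cs \<subseteq> T" "x [^] length cs \<oplus> eval cs x = \<zero>"
    using integral_equation[OF int x] .
  have "eval (\<one> # cs) x = \<zero>" using cs(2) x by simp
  then have "x [^] (0::nat) \<otimes> eval (\<one> # cs) x \<in> J"
    using subring_module.zero_mem[OF subring_ideal.axioms(1)[OF J]] by simp
  moreover have "set (\<one> # cs) \<subseteq> T" "\<not> set (\<one> # cs) \<subseteq> M"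
    using cs(1) subring_maximalideal.one_notin[OF M(1)] by auto
  ultimately show "\<exists>n::nat. \<exists>y\<in>U. x [^] n \<otimes> (\<one> \<ominus> y \<otimes> x) \<in> J"
    using ex_pi_regular_if_eval_mem[OF J M x] by blast
qed

end

context cring_subring
begin

lemma strongly_pi_regular_mod_mult:
  assumes I: "strongly_pi_regular_mod U I" and J: "strongly_pi_regular_mod U J"
    and IJ: "\<And>u v. \<lbrakk>u \<in> I; v \<in> J\<rbrakk> \<Longrightarrow> u \<otimes> v \<in> K"
  shows "strongly_pi_regular_mod U K"
  unfolding strongly_pi_regular_mod_def
proof
  fix x assume x: "x \<in> U"
  obtain n y where y: "y \<in> U" "x [^] (n::nat) \<otimes> (\<one> \<ominus> y \<otimes> x) \<in> I"
    using I x unfolding strongly_pi_regular_mod_def by blast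
  obtain m z where z: "z \<in> U" "x [^] (m::nat) \<otimes> (\<one> \<ominus> z \<otimes> x) \<in> J"
    using J x unfolding strongly_pi_regular_mod_def by blast
  have "x [^] (n + m) = x [^] n \<otimes> x [^] m" using x by (simp add: nat_pow_mult)
  then have "x [^] (n + m) \<otimes> (\<one> \<ominus> (y \<oplus> z \<ominus> y \<otimes> z \<otimes> x) \<otimes> x)
      = (x [^] n \<otimes> (\<one> \<ominus> y \<otimes> x)) \<otimes> (x [^] m \<otimes> (\<one> \<ominus> z \<otimes> x))"
    using x y(1) z(1) by algebra
  also have "\<dots> \<in> K" using IJ y(2) z(2) by blast
  finally have "x [^] (n + m) \<otimes> (\<one> \<ominus> (y \<oplus> z \<ominus> y \<otimes> z \<otimes> x) \<otimes> x) \<in> K" .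
  moreover have "y \<oplus> z \<ominus> y \<otimes> z \<otimes> x \<in> U" using x y(1) z(1) by simp
  ultimately show "\<exists>n::nat. \<exists>y\<in>U. x [^] n \<otimes> (\<one> \<ominus> y \<otimes> x) \<in> K" by blast
qed

lemma strongly_pi_regular_mod_idempotent:
  assumes "strongly_pi_regular_mod U J" and J: "subring_ideal R U J" and x: "x \<in> U"
  obtains n :: nat and y where "n > 0" "y \<in> U" "x [^] n \<otimes> (\<one> \<ominus> y \<otimes> x) \<in> J"
    "(y \<otimes> x) [^] n \<otimes> (y \<otimes> x) [^] n \<ominus> (y \<otimes> x) [^] n \<in> J"
proof -
  interpret J: subring_ideal R U J by (rule J)
  obtain m y where y: "y \<in> U" "x [^] (m::nat) \<otimes> (\<one> \<ominus> y \<otimes> x) \<in> J"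
    using assms unfolding strongly_pi_regular_mod_def by blast
  define n where "n = Suc m"
  have "x [^] n \<otimes> (\<one> \<ominus> y \<otimes> x) = x \<otimes> (x [^] m \<otimes> (\<one> \<ominus> y \<otimes> x))"
    unfolding n_def nat_pow_Suc using x y(1) by algebra
  also have "\<dots> \<in> J" using x y(2) by simp
  finally have mem: "x [^] n \<otimes> (\<one> \<ominus> y \<otimes> x) \<in> J" .
  have "\<one> [^] n \<ominus> (y \<otimes> x) [^] n \<in> {z \<in> carrier R. x [^] n \<otimes> z \<in> J}"
    using mem x y(1) by (intro subring_module.pow_cong[OF J.vimage_module]) simp_all
  then have "x [^] n \<otimes> (\<one> \<ominus> (y \<otimes> x) [^] n) \<in> J" by simp
  then have "\<ominus> (y [^] n \<otimes> (x [^] n \<otimes> (\<one> \<ominus> (y \<otimes> x) [^] n))) \<in> J" using y(1) by simp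
  moreover have "(y \<otimes> x) [^] n = y [^] n \<otimes> x [^] n" using x y(1) by (simp add: nat_pow_distrib)
  then have "\<ominus> (y [^] n \<otimes> (x [^] n \<otimes> (\<one> \<ominus> (y \<otimes> x) [^] n)))
      = (y \<otimes> x) [^] n \<otimes> (y \<otimes> x) [^] n \<ominus> (y \<otimes> x) [^] n"
    using x y(1) by algebra
  ultimately show thesis using that[of n y] mem y(1) unfolding n_def by simp
qed

end

lemma (in ring_extension) FCP_strongly_pi_regular_mod_conductor:
  assumes int: "integral_extension R T U" and fcp: "FCP R T U"
  shows "strongly_pi_regular_mod U (conductor R T U)"
  using fcp subring_intermediate U.is_subring
proof (induct rule: FCP_induct)
  case top
  have "\<one> \<ominus> \<zero> \<otimes> x \<in> U" if "x \<in> U" for x using that by simp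
  then show ?case
    unfolding strongly_pi_regular_mod_def conductor_def
    by (intro ballI exI[of _ 0] bexI[of _ \<zero>]) simp_all
next
  case (minimal_step B C)
  interpret BU: ring_extension R B U using minimal_step(1) by (rule intermediate_ring_extension)
  interpret CU: ring_extension R C U using minimal_step(2) by (rule intermediate_ring_extension)
  have int': "integral_extension R B U" "integral_extension R B C"
    using integral_extension_mono[OF int] minimal_step(1,2) unfolding intermediate_rings_def by auto
  interpret BC: minimal_integral_extension R B C
    using minimal_step(3) int'(2) by (rule minimal_integral_extensionI)
  let ?J = "{x \<in> U. \<forall>y\<in>conductor R C U. x \<otimes> y \<in> B}"
  have "conductor R B C \<subseteq> ?J"
    using CU.subset CU.conductor_subset unfolding conductor_def[of R B C] by blast
  then have "strongly_pi_regular_mod U ?J"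
    using BU.integral_strongly_pi_regular_mod[OF int'(1)
        BU.colon_ideal[OF CU.conductor.subring_ideal_axioms] BC.conductor_maximalideal] by blast
  moreover have "u \<otimes> v \<in> conductor R B U" if "u \<in> ?J" "v \<in> conductor R C U" for u v
    using CU.conductor.subring_ideal_axioms that by (rule BU.colon_mult_mem_conductor)
  ultimately show ?case
    using U.strongly_pi_regular_mod_mult[OF _ minimal_step(4)] by blast
qed

subsection \<open>u-closed extensions and i-extensions\<close>

context ring_extension
begin

lemma u_closed_iff:
  "u_closed R T U \<longleftrightarrow> (\<forall>b\<in>U. b \<otimes> b \<ominus> b \<in> T \<longrightarrow> (b \<otimes> b \<ominus> b) \<otimes> b \<in> T \<longrightarrow> b \<in> T)"
proof -
  have "b [^] (2::nat) \<ominus> b = b \<otimes> b \<ominus> b"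
    "b [^] (3::nat) \<ominus> b [^] (2::nat) = (b \<otimes> b \<ominus> b) \<otimes> b" if "b \<in> U" for b
  proof -
    show "b [^] (2::nat) \<ominus> b = b \<otimes> b \<ominus> b" using that by (simp add: numeral_2_eq_2)
    have "b [^] (3::nat) \<ominus> b [^] (2::nat) = b \<otimes> b \<otimes> b \<ominus> b \<otimes> b"
      using that by (simp add: numeral_2_eq_2 numeral_3_eq_3)
    then show "b [^] (3::nat) \<ominus> b [^] (2::nat) = (b \<otimes> b \<ominus> b) \<otimes> b" using that by algebra
  qed
  then show ?thesis unfolding u_closed_def by simp
qed

lemma u_closed_idempotent_mem:
  assumes "u_closed R T U" "e \<in> U" "e \<otimes> e \<ominus> e \<in> conductor R T U"
  shows "e \<in> T"
  using assms conductor_subset conductor.smult_mem_right[OF assms(3,2)]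
  unfolding u_closed_iff by blast

theorem u_closed_imp_i_extension:
  assumes int: "integral_extension R T U" and fcp: "FCP R T U" and u: "u_closed R T U"
  shows "i_extension R T U"
proof -
  have "P \<subseteq> Q"
    if "subring_primeideal R U P" "subring_primeideal R U Q" and eq: "P \<inter> T = Q \<inter> T" for P Q
  proof (rule ccontr)
    interpret P: subring_primeideal R U P by fact
    interpret Q: subring_primeideal R U Q by fact
    assume "\<not> P \<subseteq> Q"
    then obtain x where x: "x \<in> P" "x \<notin> Q" by blast
    obtain n y where n: "n > 0" and y: "y \<in> U"
      and mem: "x [^] (n::nat) \<otimes> (\<one> \<ominus> y \<otimes> x) \<in> conductor R T U"
      and idem: "(y \<otimes> x) [^] n \<otimes> (y \<otimes> x) [^] n \<ominus> (y \<otimes> x) [^] n \<in> conductor R T U"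
      using U.strongly_pi_regular_mod_idempotent[OF FCP_strongly_pi_regular_mod_conductor[OF int fcp]
          conductor.subring_ideal_axioms P.mem_subring[OF x(1)]] .
    have power: "z [^] n \<in> P" if "z \<in> P" for z
      using that n by (cases n) simp_all
    have "x [^] n \<otimes> (\<one> \<ominus> y \<otimes> x) \<in> P" using power x(1) y by simp
    then have "x [^] n \<otimes> (\<one> \<ominus> y \<otimes> x) \<in> Q" using mem eq conductor_subset by blast
    then have one_minus: "\<one> \<ominus> y \<otimes> x \<in> Q"
      using Q.prime[of "x [^] n" "\<one> \<ominus> y \<otimes> x"] Q.pow_mem_imp_mem[of x n] x y by simp blast
    have "(y \<otimes> x) [^] n \<in> T"
      using u_closed_idempotent_mem[OF u _ idem] x(1) y by simp
    moreover have "(y \<otimes> x) [^] n \<in> P" using power x(1) y by simp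
    ultimately have "(y \<otimes> x) [^] n \<in> Q" using eq by blast
    then have "y \<otimes> x \<in> Q" using Q.pow_mem_imp_mem[of "y \<otimes> x" n] x(1) y by simp
    then have "(\<one> \<ominus> y \<otimes> x) \<oplus> y \<otimes> x \<in> Q" using one_minus by simp
    moreover have "(\<one> \<ominus> y \<otimes> x) \<oplus> y \<otimes> x = \<one>" using x(1) y by algebra
    ultimately show False by simp
  qed
  then show ?thesis unfolding i_extension_iff by blast
qed

lemma quadratic_extension_anodal:
  assumes b: "b \<in> U" and c: "b \<otimes> b \<ominus> b \<in> T"
  shows "quadratic_extension R T b (b \<otimes> b \<ominus> b) \<one>"
    and "quadratic_extension R T (\<one> \<ominus> b) (b \<otimes> b \<ominus> b) \<one>"
proof -
  have "b \<otimes> b = \<one> \<otimes> b \<oplus> (b \<otimes> b \<ominus> b)"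
    "(\<one> \<ominus> b) \<otimes> (\<one> \<ominus> b) = \<one> \<otimes> (\<one> \<ominus> b) \<oplus> (b \<otimes> b \<ominus> b)"
    using b by algebra+
  then show "quadratic_extension R T b (b \<otimes> b \<ominus> b) \<one>"
    "quadratic_extension R T (\<one> \<ominus> b) (b \<otimes> b \<ominus> b) \<one>"
    using b c by unfold_locales simp_all
qed

lemma line_extension_one_minus:
  assumes b: "b \<in> carrier R"
  shows "line_extension T (\<one> \<ominus> b) T = line_extension T b T"
proof -
  have sub: "line_extension T (\<one> \<ominus> a) T \<subseteq> line_extension T a T" if "a \<in> carrier R" for a
  proof
    fix u assume "u \<in> line_extension T (\<one> \<ominus> a) T"
    then obtain t x where repr: "t \<in> T" "x \<in> T" "u = t \<otimes> (\<one> \<ominus> a) \<oplus> x"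
      unfolding line_extension_mem_iff by blast
    then have "u = (\<ominus> t) \<otimes> a \<oplus> (t \<oplus> x)" using that by algebra
    then show "u \<in> line_extension T a T"
      using repr subring_module.mem_line_extension[OF T.subring_module_self] by simp
  qed
  have "\<one> \<ominus> (\<one> \<ominus> b) = b" using b by algebra
  then show ?thesis using sub[OF b] sub[of "\<one> \<ominus> b"] b by auto
qed

text \<open>Every prime \<open>M\<close> of \<open>T\<close> containing the conductor of \<open>T[b]\<close> has the two extensions \<open>M + T b\<close> and
  \<open>M + T (1 - b)\<close> to \<open>T[b]\<close>.\<close>

lemma not_i_extension_line_extension:
  assumes b: "b \<in> U" "b \<notin> T" and c: "b \<otimes> b \<ominus> b \<in> T" "(b \<otimes> b \<ominus> b) \<otimes> b \<in> T"
  shows "\<not> i_extension R T (line_extension T b T)"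
proof
  let ?c = "b \<otimes> b \<ominus> b" and ?C = "conductor R T (line_extension T b T)"
  assume i: "i_extension R T (line_extension T b T)"
  interpret Tb: quadratic_extension R T b ?c \<one> using b(1) c(1) by (rule quadratic_extension_anodal)
  interpret Tb': quadratic_extension R T "\<one> \<ominus> b" ?c \<one>
    using b(1) c(1) by (rule quadratic_extension_anodal)
  have Tb_eq: "line_extension T (\<one> \<ominus> b) T = line_extension T b T"
    using b(1) by (simp add: line_extension_one_minus)
  have "\<one> \<otimes> b \<notin> T" using b by simp
  then have "\<one> \<notin> ?C" unfolding Tb.T_b.mem_conductor_iff using Tb.b_mem by blast
  then obtain M where M: "subring_primeideal R T M" "?C \<subseteq> M"
    using T.ex_primeideal_superset[OF Tb.T_b.conductor_ideal_subring] by blast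
  have c_mem: "?c \<in> M" using Tb.mem_conductor[OF c] M(2) by blast
  note prime = Tb.primeideal_line_extension[OF M c_mem]
  note prime' = Tb'.primeideal_line_extension[OF M(1) _ c_mem, unfolded Tb_eq, OF M(2)]
  have eq: "line_extension T b M = line_extension T (\<one> \<ominus> b) M"
    using i prime prime' unfolding Tb.T_b.i_extension_iff by blast
  interpret P: subring_primeideal R "line_extension T b T" "line_extension T b M" by (rule prime)
  interpret M: subring_primeideal R T M by (rule M)
  have "b \<in> line_extension T b M" "\<one> \<ominus> b \<in> line_extension T b M"
    using M.line_extension_superset(2)[of b] M.line_extension_superset(2)[of "\<one> \<ominus> b"] b(1)
    unfolding eq[symmetric] by simp_all
  then have "(\<one> \<ominus> b) \<oplus> b \<in> line_extension T b M" by simp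
  moreover have "(\<one> \<ominus> b) \<oplus> b = \<one>" using b(1) by algebra
  ultimately show False using P.one_notin by simp
qed

lemma line_extension_intermediate:
  assumes b: "b \<in> U" and "b \<otimes> b \<ominus> b \<in> T"
  shows "line_extension T b T \<in> intermediate_rings R T U"
proof -
  interpret Tb: quadratic_extension R T b "b \<otimes> b \<ominus> b" \<one>
    using assms by (rule quadratic_extension_anodal)
  have "line_extension T b T \<subseteq> U"
    using b subset by (rule subring_module.line_extension_least[OF overring_module])
  with Tb.subring_line_extension Tb.T_b.subset show ?thesis by (rule intermediate_ringI)
qed

theorem i_extension_imp_u_closed:
  assumes int: "integral_extension R T U" and i: "i_extension R T U"
  shows "u_closed R T U"
  unfolding u_closed_iff
proof (intro ballI impI)
  fix b assume b: "b \<in> U" and c: "b \<otimes> b \<ominus> b \<in> T" "(b \<otimes> b \<ominus> b) \<otimes> b \<in> T"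
  have Tb: "line_extension T b T \<in> intermediate_rings R T U"
    using b c(1) by (rule line_extension_intermediate)
  then have "T \<subseteq> line_extension T b T" unfolding intermediate_rings_def by blast
  with subring_intermediate Tb have "i_extension R T (line_extension T b T)"
    using int i by (rule i_extension_intermediate)
  then show "b \<in> T" using not_i_extension_line_extension[OF b _ c] by blast
qed

end

subsection \<open>Fraction fields\<close>

context domain
begin

lemma fraction_class_eq_iff:
  assumes "a \<in> carrier R" "s \<in> carrier R - {\<zero>}" "b \<in> carrier R" "t \<in> carrier R - {\<zero>}"
  shows "fraction_class R a s = fraction_class R b t \<longleftrightarrow> a \<otimes> t = b \<otimes> s"
proof
  assume "fraction_class R a s = fraction_class R b t"
  moreover have "(b, t) \<in> fraction_class R b t"
    using assms(3,4) unfolding fraction_class_def by simp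
  ultimately show "a \<otimes> t = b \<otimes> s" unfolding fraction_class_def by auto
next
  have sub: "fraction_class R a s \<subseteq> fraction_class R b t"
    if "a \<in> carrier R" "s \<in> carrier R - {\<zero>}" "b \<in> carrier R" "t \<in> carrier R - {\<zero>}"
      and eq: "a \<otimes> t = b \<otimes> s" for a s b t
  proof
    fix x assume "x \<in> fraction_class R a s"
    then obtain d u where du: "x = (d, u)" "d \<in> carrier R" "u \<in> carrier R" "u \<noteq> \<zero>" "a \<otimes> u = d \<otimes> s"
      unfolding fraction_class_def by blast
    have "s \<otimes> (b \<otimes> u) = (a \<otimes> t) \<otimes> u" unfolding eq using that(1-4) du(2,3) by (simp add: m_ac)
    also have "\<dots> = (a \<otimes> u) \<otimes> t" using that(1-4) du(2,3) by (simp add: m_ac)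
    also have "\<dots> = s \<otimes> (d \<otimes> t)" unfolding du(5) using that(1-4) du(2,3) by (simp add: m_ac)
    finally have "b \<otimes> u = d \<otimes> t" using that(1-4) du(2,3) m_lcancel[of s] by simp
    then show "x \<in> fraction_class R b t" using du unfolding fraction_class_def by simp
  qed
  assume "a \<otimes> t = b \<otimes> s"
  then show "fraction_class R a s = fraction_class R b t"
    using sub[of a s b t] sub[of b t a s] assms by simp
qed

lemma fraction_class_UN:
  assumes "a \<in> carrier R" "s \<in> carrier R - {\<zero>}"
    and "\<And>b t. \<lbrakk>b \<in> carrier R; t \<in> carrier R - {\<zero>}; a \<otimes> t = b \<otimes> s\<rbrakk> \<Longrightarrow> F b t = A"
  shows "(\<Union>(b, t)\<in>fraction_class R a s. F b t) = A"
proof -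
  have "(a, s) \<in> fraction_class R a s" using assms(1,2) unfolding fraction_class_def by simp
  moreover have "F b t = A" if "(b, t) \<in> fraction_class R a s" for b t
    using that assms(3)[of b t] unfolding fraction_class_def by blast
  ultimately show ?thesis by fast
qed

lemma fraction_field_mult:
  assumes "a \<in> carrier R" "s \<in> carrier R - {\<zero>}" "b \<in> carrier R" "t \<in> carrier R - {\<zero>}"
  shows "fraction_class R a s \<otimes>\<^bsub>fraction_field R\<^esub> fraction_class R b t
    = fraction_class R (a \<otimes> b) (s \<otimes> t)"
proof -
  have "fraction_class R (a' \<otimes> b') (s' \<otimes> t') = fraction_class R (a \<otimes> b) (s \<otimes> t)"
    if equiv: "a' \<in> carrier R" "s' \<in> carrier R - {\<zero>}" "a \<otimes> s' = a' \<otimes> s"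
      "b' \<in> carrier R" "t' \<in> carrier R - {\<zero>}" "b \<otimes> t' = b' \<otimes> t" for a' s' b' t'
  proof -
    have "(a' \<otimes> b') \<otimes> (s \<otimes> t) = (a' \<otimes> s) \<otimes> (b' \<otimes> t)"
      using assms equiv(1,2,4,5) by (simp add: m_ac)
    also have "\<dots> = (a \<otimes> b) \<otimes> (s' \<otimes> t')"
      unfolding equiv(3,6)[symmetric] using assms equiv(1,2,4,5) by (simp add: m_ac)
    finally show ?thesis
      using assms equiv by (subst fraction_class_eq_iff) (auto simp: integral_iff)
  qed
  then show ?thesis
    unfolding fraction_field_def monoid.simps
    by (intro fraction_class_UN[OF assms(1,2)] fraction_class_UN[OF assms(3,4)])
qed

lemma fraction_field_add:
  assumes "a \<in> carrier R" "s \<in> carrier R - {\<zero>}" "b \<in> carrier R" "t \<in> carrier R - {\<zero>}"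
  shows "fraction_class R a s \<oplus>\<^bsub>fraction_field R\<^esub> fraction_class R b t
    = fraction_class R (a \<otimes> t \<oplus> b \<otimes> s) (s \<otimes> t)"
proof -
  have "fraction_class R (a' \<otimes> t' \<oplus> b' \<otimes> s') (s' \<otimes> t') = fraction_class R (a \<otimes> t \<oplus> b \<otimes> s) (s \<otimes> t)"
    if equiv: "a' \<in> carrier R" "s' \<in> carrier R - {\<zero>}" "a \<otimes> s' = a' \<otimes> s"
      "b' \<in> carrier R" "t' \<in> carrier R - {\<zero>}" "b \<otimes> t' = b' \<otimes> t" for a' s' b' t'
  proof -
    have carrier: "s \<in> carrier R" "t \<in> carrier R" "s' \<in> carrier R" "t' \<in> carrier R"
      using assms equiv by auto
    have "(a' \<otimes> t' \<oplus> b' \<otimes> s') \<otimes> (s \<otimes> t) = (a' \<otimes> s) \<otimes> (t' \<otimes> t) \<oplus> (b' \<otimes> t) \<otimes> (s' \<otimes> s)"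
      using assms(1,3) equiv(1,4) carrier by algebra
    also have "\<dots> = (a \<otimes> t \<oplus> b \<otimes> s) \<otimes> (s' \<otimes> t')"
      unfolding equiv(3,6)[symmetric] using assms(1,3) equiv(1,4) carrier by algebra
    finally show ?thesis
      using assms equiv by (subst fraction_class_eq_iff) (auto simp: integral_iff)
  qed
  then show ?thesis
    unfolding fraction_field_def ring.simps
    by (intro fraction_class_UN[OF assms(1,2)] fraction_class_UN[OF assms(3,4)])
qed

lemma fraction_field_carrierE:
  assumes "x \<in> carrier (fraction_field R)"
  obtains a s where "a \<in> carrier R" "s \<in> carrier R - {\<zero>}" "x = fraction_class R a s"
  using assms unfolding fraction_field_def by auto

lemma fraction_class_closed:
  "\<lbrakk>a \<in> carrier R; s \<in> carrier R - {\<zero>}\<rbrakk> \<Longrightarrow> fraction_class R a s \<in> carrier (fraction_field R)"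
  unfolding fraction_field_def by auto

end

locale domain_embedding = D: domain D + E: domain E + ring_hom_ring D E h
  for D (structure) and E and h +
  assumes inj: "inj_on h (carrier D)"
begin

lemma hom_nonzero: "s \<in> carrier D - {\<zero>\<^bsub>D\<^esub>} \<Longrightarrow> h s \<in> carrier E - {\<zero>\<^bsub>E\<^esub>}"
  using inj_onD[OF inj, of s "\<zero>\<^bsub>D\<^esub>"] by auto

lemma fraction_map_class:
  assumes "a \<in> carrier D" "s \<in> carrier D - {\<zero>\<^bsub>D\<^esub>}"
  shows "fraction_map E h (fraction_class D a s) = fraction_class E (h a) (h s)"
  unfolding fraction_map_def
proof (rule D.fraction_class_UN[OF assms])
  fix b t assume equiv: "b \<in> carrier D" "t \<in> carrier D - {\<zero>\<^bsub>D\<^esub>}" "a \<otimes>\<^bsub>D\<^esub> t = b \<otimes>\<^bsub>D\<^esub> s"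
  then have "h a \<otimes>\<^bsub>E\<^esub> h t = h b \<otimes>\<^bsub>E\<^esub> h s" using assms by (metis DiffD1 hom_mult)
  then show "fraction_class E (h b) (h t) = fraction_class E (h a) (h s)"
    using E.fraction_class_eq_iff[of "h b" "h t" "h a" "h s"] assms equiv hom_nonzero by simp
qed

lemma fraction_map_ring_hom: "fraction_map E h \<in> ring_hom (fraction_field D) (fraction_field E)"
proof (rule ring_hom_memI)
  fix x y assume "x \<in> carrier (fraction_field D)" "y \<in> carrier (fraction_field D)"
  then obtain a s b t where as: "a \<in> carrier D" "s \<in> carrier D - {\<zero>\<^bsub>D\<^esub>}" "x = fraction_class D a s"
    and bt: "b \<in> carrier D" "t \<in> carrier D - {\<zero>\<^bsub>D\<^esub>}" "y = fraction_class D b t"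
    by (meson D.fraction_field_carrierE)
  have product: "s \<otimes>\<^bsub>D\<^esub> t \<in> carrier D - {\<zero>\<^bsub>D\<^esub>}" using as(2) bt(2) by (auto simp: D.integral_iff)
  show "fraction_map E h (x \<otimes>\<^bsub>fraction_field D\<^esub> y)
      = fraction_map E h x \<otimes>\<^bsub>fraction_field E\<^esub> fraction_map E h y"
    using as bt product hom_nonzero
    by (simp add: D.fraction_field_mult E.fraction_field_mult fraction_map_class)
  show "fraction_map E h (x \<oplus>\<^bsub>fraction_field D\<^esub> y)
      = fraction_map E h x \<oplus>\<^bsub>fraction_field E\<^esub> fraction_map E h y"
    using as bt product hom_nonzero
    by (simp add: D.fraction_field_add E.fraction_field_add fraction_map_class)
next
  fix x assume "x \<in> carrier (fraction_field D)"
  then obtain a s where as: "a \<in> carrier D" "s \<in> carrier D - {\<zero>\<^bsub>D\<^esub>}" "x = fraction_class D a s"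
    by (rule D.fraction_field_carrierE)
  then show "fraction_map E h x \<in> carrier (fraction_field E)"
    using E.fraction_class_closed[OF _ hom_nonzero] by (simp add: fraction_map_class)
next
  show "fraction_map E h \<one>\<^bsub>fraction_field D\<^esub> = \<one>\<^bsub>fraction_field E\<^esub>"
    using fraction_map_class[of "\<one>\<^bsub>D\<^esub>" "\<one>\<^bsub>D\<^esub>"] unfolding fraction_field_def by simp
qed

lemma fraction_map_inj: "inj_on (fraction_map E h) (carrier (fraction_field D))"
proof (rule inj_onI)
  fix x y assume "x \<in> carrier (fraction_field D)" "y \<in> carrier (fraction_field D)"
    and eq: "fraction_map E h x = fraction_map E h y"
  then obtain a s b t where as: "a \<in> carrier D" "s \<in> carrier D - {\<zero>\<^bsub>D\<^esub>}" "x = fraction_class D a s"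
    and bt: "b \<in> carrier D" "t \<in> carrier D - {\<zero>\<^bsub>D\<^esub>}" "y = fraction_class D b t"
    by (meson D.fraction_field_carrierE)
  have "h a \<otimes>\<^bsub>E\<^esub> h t = h b \<otimes>\<^bsub>E\<^esub> h s"
    using eq E.fraction_class_eq_iff[of "h a" "h s" "h b" "h t"] as bt hom_nonzero
    by (simp add: fraction_map_class)
  then have "h (a \<otimes>\<^bsub>D\<^esub> t) = h (b \<otimes>\<^bsub>D\<^esub> s)" using as bt by simp
  then have "a \<otimes>\<^bsub>D\<^esub> t = b \<otimes>\<^bsub>D\<^esub> s" using inj_onD[OF inj] as bt by simp
  then show "x = y" using D.fraction_class_eq_iff as bt by simp
qed

lemma fraction_class_mem_image:
  assumes as: "a \<in> carrier D" "s \<in> carrier D - {\<zero>\<^bsub>D\<^esub>}"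
    and bt: "b \<in> carrier D" "t \<in> carrier D - {\<zero>\<^bsub>D\<^esub>}"
    and ef: "e \<in> carrier E" "f \<in> carrier E - {\<zero>\<^bsub>E\<^esub>}"
    and e_eq: "h s \<otimes>\<^bsub>E\<^esub> e = h a" and f_eq: "h t \<otimes>\<^bsub>E\<^esub> f = h b"
  shows "fraction_class E e f \<in> fraction_map E h ` carrier (fraction_field D)"
proof -
  have "h b \<noteq> \<zero>\<^bsub>E\<^esub>"
    using f_eq hom_nonzero[OF bt(2)] ef(2) by (metis DiffD1 DiffD2 E.integral singletonI)
  then have "b \<noteq> \<zero>\<^bsub>D\<^esub>" by auto
  then have sb: "s \<otimes>\<^bsub>D\<^esub> b \<in> carrier D - {\<zero>\<^bsub>D\<^esub>}"
    using as(2) bt(1) by (auto simp: D.integral_iff)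
  have carrier: "h a \<in> carrier E" "h b \<in> carrier E" "h s \<in> carrier E" "h t \<in> carrier E" "f \<in> carrier E"
    using as bt ef by auto
  have "h (a \<otimes>\<^bsub>D\<^esub> t) \<otimes>\<^bsub>E\<^esub> f = (h s \<otimes>\<^bsub>E\<^esub> e) \<otimes>\<^bsub>E\<^esub> (h t \<otimes>\<^bsub>E\<^esub> f)"
    unfolding e_eq using as(1) bt(2) carrier by (simp add: E.m_assoc)
  also have "\<dots> = e \<otimes>\<^bsub>E\<^esub> h (s \<otimes>\<^bsub>D\<^esub> b)"
    unfolding f_eq using as(2) bt(1) carrier ef(1) by (simp add: E.m_ac)
  finally have "fraction_class E e f = fraction_class E (h (a \<otimes>\<^bsub>D\<^esub> t)) (h (s \<otimes>\<^bsub>D\<^esub> b))"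
    using E.fraction_class_eq_iff[of e f "h (a \<otimes>\<^bsub>D\<^esub> t)"] ef as(1) bt(2) hom_nonzero[OF sb]
    by (simp del: hom_mult)
  also have "\<dots> = fraction_map E h (fraction_class D (a \<otimes>\<^bsub>D\<^esub> t) (s \<otimes>\<^bsub>D\<^esub> b))"
    using fraction_map_class[OF _ sb] as(1) bt(2) by simp
  finally show ?thesis
    using D.fraction_class_closed[OF _ sb] as(1) bt(2) by simp
qed

lemma fraction_map_surj_iff:
  "carrier (fraction_field E) \<subseteq> fraction_map E h ` carrier (fraction_field D)
    \<longleftrightarrow> (\<forall>e\<in>carrier E. \<exists>a\<in>carrier D. \<exists>s\<in>carrier D - {\<zero>\<^bsub>D\<^esub>}. h s \<otimes>\<^bsub>E\<^esub> e = h a)"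
proof (intro iffI ballI subsetI)
  fix e assume "carrier (fraction_field E) \<subseteq> fraction_map E h ` carrier (fraction_field D)"
    and e: "e \<in> carrier E"
  then have "fraction_class E e \<one>\<^bsub>E\<^esub> \<in> fraction_map E h ` carrier (fraction_field D)"
    using E.fraction_class_closed[of e "\<one>\<^bsub>E\<^esub>"] by auto
  then obtain x where x: "x \<in> carrier (fraction_field D)" "fraction_class E e \<one>\<^bsub>E\<^esub> = fraction_map E h x"
    by blast
  obtain a s where as: "a \<in> carrier D" "s \<in> carrier D - {\<zero>\<^bsub>D\<^esub>}" "x = fraction_class D a s"
    using x(1) by (rule D.fraction_field_carrierE)
  have "fraction_class E e \<one>\<^bsub>E\<^esub> = fraction_class E (h a) (h s)"
    unfolding x(2) as(3) using as(1,2) by (rule fraction_map_class)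
  then have "h s \<otimes>\<^bsub>E\<^esub> e = h a"
    using E.fraction_class_eq_iff[of e "\<one>\<^bsub>E\<^esub>" "h a" "h s"] e as(1,2) hom_nonzero
    by (simp add: E.m_comm)
  then show "\<exists>a\<in>carrier D. \<exists>s\<in>carrier D - {\<zero>\<^bsub>D\<^esub>}. h s \<otimes>\<^bsub>E\<^esub> e = h a" using as by blast
next
  fix x assume frac: "\<forall>e\<in>carrier E. \<exists>a\<in>carrier D. \<exists>s\<in>carrier D - {\<zero>\<^bsub>D\<^esub>}. h s \<otimes>\<^bsub>E\<^esub> e = h a"
    and "x \<in> carrier (fraction_field E)"
  then obtain e f where ef: "e \<in> carrier E" "f \<in> carrier E - {\<zero>\<^bsub>E\<^esub>}" "x = fraction_class E e f"
    by (meson E.fraction_field_carrierE)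
  obtain a s where as: "a \<in> carrier D" "s \<in> carrier D - {\<zero>\<^bsub>D\<^esub>}" "h s \<otimes>\<^bsub>E\<^esub> e = h a"
    using frac ef(1) by blast
  obtain b t where bt: "b \<in> carrier D" "t \<in> carrier D - {\<zero>\<^bsub>D\<^esub>}" "h t \<otimes>\<^bsub>E\<^esub> f = h b"
    using frac ef(2) by blast
  show "x \<in> fraction_map E h ` carrier (fraction_field D)"
    unfolding ef(3) using as(1,2) bt(1,2) ef(1,2) as(3) bt(3) by (rule fraction_class_mem_image)
qed

theorem fraction_map_iso_iff:
  "fraction_map E h \<in> ring_iso (fraction_field D) (fraction_field E)
    \<longleftrightarrow> (\<forall>e\<in>carrier E. \<exists>a\<in>carrier D. \<exists>s\<in>carrier D - {\<zero>\<^bsub>D\<^esub>}. h s \<otimes>\<^bsub>E\<^esub> e = h a)"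
  unfolding fraction_map_surj_iff[symmetric] ring_iso_def bij_betw_def
  using fraction_map_ring_hom fraction_map_inj ring_hom_closed[OF fraction_map_ring_hom] by blast

end

subsection \<open>Residue fields and infra-integral extensions\<close>

lemma a_r_coset_subring: "a_r_coset (sub_ring R U) I u = I +>\<^bsub>R\<^esub> u"
  unfolding a_r_coset_def r_coset_def by simp

lemma carrier_subring_Quot: "carrier (sub_ring R U Quot I) = (\<lambda>u. I +>\<^bsub>R\<^esub> u) ` U"
  unfolding FactRing_def A_RCOSETS_def' a_r_coset_subring by auto

lemma zero_subring_Quot: "\<zero>\<^bsub>sub_ring R U Quot I\<^esub> = I"
  unfolding FactRing_def by simp

context subring_ideal
begin

lemma ideal_subring: "ideal I (sub_ring R U)"
  unfolding T.ideal_iff by (rule subring_ideal_axioms)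

lemma coset_ring_hom_ring: "ring_hom_ring (sub_ring R U) (sub_ring R U Quot I) (\<lambda>u. I +> u)"
  using ideal.rcos_ring_hom_ring[OF ideal_subring] unfolding a_r_coset_subring .

lemma coset_mult: "\<lbrakk>u \<in> U; v \<in> U\<rbrakk> \<Longrightarrow> (I +> u) \<otimes>\<^bsub>sub_ring R U Quot I\<^esub> (I +> v) = I +> (u \<otimes> v)"
  and coset_add: "\<lbrakk>u \<in> U; v \<in> U\<rbrakk> \<Longrightarrow> (I +> u) \<oplus>\<^bsub>sub_ring R U Quot I\<^esub> (I +> v) = I +> (u \<oplus> v)"
  and coset_one: "\<one>\<^bsub>sub_ring R U Quot I\<^esub> = I +> \<one>"
  using ring_hom_ring.homh[OF coset_ring_hom_ring]
  by (simp_all add: ring_hom_def)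

lemma coset_eq_iff:
  assumes "u \<in> U" "v \<in> U"
  shows "I +> u = I +> v \<longleftrightarrow> u \<ominus> v \<in> I"
proof -
  have "u \<ominus>\<^bsub>sub_ring R U\<^esub> v = u \<ominus> v"
    using assms(2) by (simp add: a_minus_def T.a_inv_subring)
  then show ?thesis
    using ring.quotient_eq_iff_same_a_r_cos
        [OF cring.axioms(1)[OF T.is_cring_subring] ideal_subring, of u v] assms
    by (simp add: a_r_coset_subring)
qed

lemma coset_eq_ideal_iff:
  assumes "u \<in> U"
  shows "I +> u = I \<longleftrightarrow> u \<in> I"
proof -
  have "I +> \<zero> = I" using subset_carrier by (simp add: a_coset_add_zero)
  moreover have "u \<ominus> \<zero> = u" using assms by algebra
  ultimately show ?thesis using coset_eq_iff[OF assms T.zero_mem] by simp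
qed

end

context ring_extension
begin

lemma quot_map_coset:
  assumes P: "subring_ideal R T P" and Q: "subring_ideal R U Q" and PQ: "P \<subseteq> Q" and t: "t \<in> T"
  shows "quot_map R Q (P +> t) = Q +> t"
proof -
  interpret P: subring_ideal R T P by (rule P)
  interpret Q: subring_ideal R U Q by (rule Q)
  have "Q <+>\<^bsub>R\<^esub> P = Q"
  proof
    show "Q <+>\<^bsub>R\<^esub> P \<subseteq> Q" using PQ Q.add_mem by (fastforce simp: mem_set_add)
    show "Q \<subseteq> Q <+>\<^bsub>R\<^esub> P"
    proof
      fix q assume "q \<in> Q"
      then show "q \<in> Q <+>\<^bsub>R\<^esub> P" unfolding mem_set_add by (intro bexI[of _ q] bexI[of _ \<zero>]) simp_all
    qed
  qed
  then show ?thesis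
    unfolding quot_map_def using a_setmult_rcos_assoc[OF Q.subset_carrier P.subset_carrier] t by simp
qed

lemma quot_map_image:
  assumes "subring_ideal R T P" "subring_ideal R U Q" "P \<subseteq> Q"
  shows "quot_map R Q ` carrier (sub_ring R T Quot P) = (\<lambda>t. Q +> t) ` T"
  unfolding carrier_subring_Quot image_image using quot_map_coset[OF assms] by simp

lemma quot_map_ring_hom:
  assumes P: "subring_ideal R T P" and Q: "subring_ideal R U Q" and "P \<subseteq> Q"
  shows "quot_map R Q \<in> ring_hom (sub_ring R T Quot P) (sub_ring R U Quot Q)"
proof -
  interpret P: subring_ideal R T P by (rule P)
  interpret Q: subring_ideal R U Q by (rule Q)
  note coset = quot_map_coset[OF assms]
  show ?thesis
    by (rule ring_hom_memI)
      (auto simp: carrier_subring_Quot coset P.coset_mult P.coset_add P.coset_one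
        Q.coset_mult Q.coset_add Q.coset_one)
qed

lemma quot_map_inj:
  assumes P: "subring_ideal R T P" and Q: "subring_ideal R U Q" and PQ: "Q \<inter> T = P"
  shows "inj_on (quot_map R Q) (carrier (sub_ring R T Quot P))"
proof (rule inj_onI)
  interpret P: subring_ideal R T P by (rule P)
  interpret Q: subring_ideal R U Q by (rule Q)
  have "P \<subseteq> Q" using PQ by blast
  note coset = quot_map_coset[OF P Q this]
  fix x y assume "x \<in> carrier (sub_ring R T Quot P)" "y \<in> carrier (sub_ring R T Quot P)"
    and eq: "quot_map R Q x = quot_map R Q y"
  then obtain s t where st: "s \<in> T" "t \<in> T" "x = P +> s" "y = P +> t"
    unfolding carrier_subring_Quot by blast
  then have "s \<ominus> t \<in> Q" using eq by (simp add: coset Q.coset_eq_iff)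
  then have "s \<ominus> t \<in> P" using PQ st by auto
  then show "x = y" using st by (simp add: P.coset_eq_iff)
qed

definition fractions_mod :: "'a set \<Rightarrow> 'a set \<Rightarrow> 'a set" where
  "fractions_mod W K = {x \<in> U. \<exists>s\<in>W. \<exists>t\<in>T. s \<otimes> x \<ominus> t \<in> K}"

lemma residue_map_iso_iff:
  assumes Q: "subring_primeideal R U Q"
  shows "residue_map R U Q
      \<in> ring_iso (residue_field (sub_ring R T) (Q \<inter> T)) (residue_field (sub_ring R U) Q)
    \<longleftrightarrow> U \<subseteq> fractions_mod (T - Q) Q"
proof -
  interpret Q: subring_primeideal R U Q by (rule Q)
  interpret P: subring_primeideal R T "Q \<inter> T" using Q by (rule subring_primeideal_Int)
  let ?D = "sub_ring R T Quot (Q \<inter> T)" and ?E = "sub_ring R U Quot Q"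
  have dom: "domain ?D" "domain ?E"
    using P.subring_primeideal_axioms Q
    unfolding T.primeideal_iff[symmetric] U.primeideal_iff[symmetric]
    by (auto intro: primeideal.quotient_is_domain)
  have "quot_map R Q \<in> ring_hom ?D ?E"
    using P.subring_ideal_axioms Q.subring_ideal_axioms by (rule quot_map_ring_hom) blast
  moreover have "inj_on (quot_map R Q) (carrier ?D)"
    using P.subring_ideal_axioms Q.subring_ideal_axioms refl by (rule quot_map_inj)
  ultimately interpret domain_embedding ?D ?E "quot_map R Q"
    using dom by (simp add: domain_embedding_def domain_embedding_axioms_def ring_hom_ring_def
        ring_hom_ring_axioms_def domain_def cring_def)
  have coset: "quot_map R Q (Q \<inter> T +> t) = Q +> t" if "t \<in> T" for t
    using P.subring_ideal_axioms Q.subring_ideal_axioms Int_lower1 that by (rule quot_map_coset)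
  have nonzero: "carrier ?D - {\<zero>\<^bsub>?D\<^esub>} = (\<lambda>s. Q \<inter> T +> s) ` (T - Q)"
    using P.coset_eq_ideal_iff unfolding carrier_subring_Quot zero_subring_Quot by auto
  have "quot_map R Q (Q \<inter> T +> s) \<otimes>\<^bsub>?E\<^esub> (Q +> x) = quot_map R Q (Q \<inter> T +> t) \<longleftrightarrow> s \<otimes> x \<ominus> t \<in> Q"
    if "s \<in> T" "x \<in> U" "t \<in> T" for s x t
    using that by (simp add: coset Q.coset_mult Q.coset_eq_iff)
  then have "(\<exists>a\<in>carrier ?D. \<exists>s\<in>carrier ?D - {\<zero>\<^bsub>?D\<^esub>}. quot_map R Q s \<otimes>\<^bsub>?E\<^esub> (Q +> x) = quot_map R Q a)
      \<longleftrightarrow> x \<in> fractions_mod (T - Q) Q" if "x \<in> U" for x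
    using that unfolding nonzero unfolding carrier_subring_Quot fractions_mod_def by auto
  then show ?thesis
    unfolding residue_map_def residue_field_def fraction_map_iso_iff carrier_subring_Quot[where U = U]
    by auto
qed

lemma infra_integral_iff:
  "infra_integral R T U \<longleftrightarrow> integral_extension R T U \<and>
    (\<forall>Q. subring_primeideal R U Q \<longrightarrow> U \<subseteq> fractions_mod (T - Q) Q)"
  unfolding infra_integral_def Spec_def U.primeideal_iff using residue_map_iso_iff by auto

lemma subintegral_iff:
  "subintegral R T U \<longleftrightarrow> integral_extension R T U \<and>
    (\<forall>P Q. subring_primeideal R U P \<longrightarrow> subring_primeideal R U Q \<longrightarrow> P \<inter> T = Q \<inter> T \<longrightarrow>
      U \<subseteq> fractions_mod (T - Q) (P \<inter> Q))" (is "_ \<longleftrightarrow> _ \<and> ?fractions")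
proof
  assume "subintegral R T U"
  then show "integral_extension R T U \<and> ?fractions"
    unfolding subintegral_def infra_integral_iff i_extension_iff by (metis Int_absorb)
next
  assume fractions: "integral_extension R T U \<and> ?fractions"
  have "P \<subseteq> Q" if P: "subring_primeideal R U P" and Q: "subring_primeideal R U Q"
    and eq: "P \<inter> T = Q \<inter> T" for P Q
  proof
    interpret P: subring_primeideal R U P by (rule P)
    interpret Q: subring_primeideal R U Q by (rule Q)
    fix x assume x: "x \<in> P"
    then have "x \<in> fractions_mod (T - Q) (P \<inter> Q)" using fractions P Q eq P.subset by blast
    then obtain s t where st: "s \<in> T" "s \<notin> Q" "t \<in> T" "s \<otimes> x \<ominus> t \<in> P" "s \<otimes> x \<ominus> t \<in> Q"
      unfolding fractions_mod_def by blast
    have "t = s \<otimes> x \<ominus> (s \<otimes> x \<ominus> t)" using st(1,3) x by algebra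
    also have "\<dots> \<in> P" using st(1,4) x by simp
    finally have "t \<in> Q" using eq st(3) by blast
    then have "(s \<otimes> x \<ominus> t) \<oplus> t \<in> Q" using st(5) by simp
    moreover have "(s \<otimes> x \<ominus> t) \<oplus> t = s \<otimes> x" using st(1,3) x by algebra
    ultimately show "x \<in> Q" using Q.prime[of s x] st(1,2) x by simp
  qed
  then have "i_extension R T U" unfolding i_extension_iff by blast
  moreover have "infra_integral R T U"
    using fractions unfolding infra_integral_iff by (metis Int_absorb)
  ultimately show "subintegral R T U" unfolding subintegral_def by blast
qed

lemma subring_fractions_mod:
  assumes W: "W \<subseteq> T" "\<one> \<in> W" "\<And>v w. \<lbrakk>v \<in> W; w \<in> W\<rbrakk> \<Longrightarrow> v \<otimes> w \<in> W"
    and K: "subring_ideal R U K"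
  shows "subring (fractions_mod W K) R"
proof (rule subringI)
  interpret K: subring_ideal R U K by (rule K)
  have memI: "x \<in> fractions_mod W K" if "x \<in> U" "s \<in> W" "t \<in> T" "s \<otimes> x \<ominus> t \<in> K" for x s t
    using that unfolding fractions_mod_def by blast
  show "fractions_mod W K \<subseteq> carrier R" unfolding fractions_mod_def by auto
  have "\<one> \<otimes> \<one> \<ominus> \<one> \<in> K" by (simp add: a_minus_def r_neg)
  then show "\<one> \<in> fractions_mod W K" using W(2) by (intro memI[of \<one> \<one> \<one>]) simp_all
  {
    fix x assume "x \<in> fractions_mod W K"
    then obtain s t where repr: "x \<in> U" "s \<in> W" "t \<in> T" "s \<otimes> x \<ominus> t \<in> K"
      unfolding fractions_mod_def by blast
    have s: "s \<in> T" using repr(2) W(1) by blast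
    have "s \<otimes> (\<ominus> x) \<ominus> (\<ominus> t) = \<ominus> (s \<otimes> x \<ominus> t)" using repr(1,3) s by algebra
    then show "\<ominus> x \<in> fractions_mod W K" using memI[of "\<ominus> x" s "\<ominus> t"] repr by simp
    fix y assume "y \<in> fractions_mod W K"
    then obtain p q where repr_y: "y \<in> U" "p \<in> W" "q \<in> T" "p \<otimes> y \<ominus> q \<in> K"
      unfolding fractions_mod_def by blast
    have p: "p \<in> T" using repr_y(2) W(1) by blast
    have "(s \<otimes> p) \<otimes> (x \<otimes> y) \<ominus> t \<otimes> q = (p \<otimes> y) \<otimes> (s \<otimes> x \<ominus> t) \<oplus> t \<otimes> (p \<otimes> y \<ominus> q)"
      using repr(1,3) s repr_y(1,3) p by algebra
    then show "x \<otimes> y \<in> fractions_mod W K"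
      using memI[of "x \<otimes> y" "s \<otimes> p" "t \<otimes> q"] repr repr_y s p W(3) by simp
    have "(s \<otimes> p) \<otimes> (x \<oplus> y) \<ominus> (p \<otimes> t \<oplus> s \<otimes> q) = p \<otimes> (s \<otimes> x \<ominus> t) \<oplus> s \<otimes> (p \<otimes> y \<ominus> q)"
      using repr(1,3) s repr_y(1,3) p by algebra
    then show "x \<oplus> y \<in> fractions_mod W K"
      using memI[of "x \<oplus> y" "s \<otimes> p" "p \<otimes> t \<oplus> s \<otimes> q"] repr repr_y s p W(3) by simp
  }
qed

end

subsection \<open>Seminormalization and t-closure\<close>

context quadratic_extension
begin

lemma notin_primeideal_or_cong:
  assumes "subring_primeideal R T_b Q"
  shows "p \<notin> Q \<or> (\<exists>y\<in>T. b \<ominus> y \<in> Q)"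
proof -
  interpret Q: subring_primeideal R T_b Q by fact
  have "b \<otimes> (b \<ominus> q) = b \<otimes> b \<ominus> q \<otimes> b" using b q by algebra
  also have "\<dots> = p" unfolding b_square using b p q by algebra
  finally have "p \<in> Q \<Longrightarrow> b \<in> Q \<or> b \<ominus> q \<in> Q" using Q.prime[of b "b \<ominus> q"] by simp
  moreover have "b \<ominus> \<zero> = b" using b by algebra
  ultimately show ?thesis using q T.zero_mem by metis
qed

lemma subset_fractions_mod:
  assumes Q: "subring_primeideal R T_b Q" and pb: "p \<otimes> b \<in> T"
  shows "T_b \<subseteq> T_b.fractions_mod (T - Q) Q"
proof
  interpret Q: subring_primeideal R T_b Q by (rule Q)
  fix u assume u: "u \<in> T_b"
  then obtain t x where tx: "t \<in> T" "x \<in> T" "u = t \<otimes> b \<oplus> x"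
    unfolding line_extension_mem_iff by blast
  consider (unit) "p \<notin> Q" | (cong) y where "y \<in> T" "b \<ominus> y \<in> Q"
    using notin_primeideal_or_cong[OF Q] by blast
  then have "\<exists>s\<in>T - Q. \<exists>y\<in>T. s \<otimes> u \<ominus> y \<in> Q"
  proof cases
    case unit
    have "p \<otimes> u \<ominus> (t \<otimes> (p \<otimes> b) \<oplus> p \<otimes> x) = \<zero>" unfolding tx(3) using tx(1,2) b p by algebra
    then have "p \<otimes> u \<ominus> (t \<otimes> (p \<otimes> b) \<oplus> p \<otimes> x) \<in> Q" by simp
    moreover have "t \<otimes> (p \<otimes> b) \<oplus> p \<otimes> x \<in> T" using pb tx(1,2) by simp
    ultimately show ?thesis using unit p by blast
  next
    case cong
    have "\<one> \<otimes> u \<ominus> (t \<otimes> y \<oplus> x) = t \<otimes> (b \<ominus> y)"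
      unfolding tx(3) using tx(1,2) b cong(1) by algebra
    also have "\<dots> \<in> Q" using cong(2) tx(1) by simp
    finally have "\<one> \<otimes> u \<ominus> (t \<otimes> y \<oplus> x) \<in> Q" .
    moreover have "t \<otimes> y \<oplus> x \<in> T" "\<one> \<in> T - Q" using cong(1) tx(1,2) by simp_all
    ultimately show ?thesis by blast
  qed
  then show "u \<in> T_b.fractions_mod (T - Q) Q" using u unfolding T_b.fractions_mod_def by blast
qed

end

context ring_extension
begin

lemma generate_ring_Union:
  assumes F: "F \<subseteq> intermediate_rings R T U" "F \<noteq> {}"
  shows "ring_extension R T (generate_ring R (\<Union>F))" "generate_ring R (\<Union>F) \<subseteq> U"
    "\<And>B. B \<in> F \<Longrightarrow> ring_extension R T B \<and> ring_extension R B (generate_ring R (\<Union>F))"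
proof -
  let ?G = "generate_ring R (\<Union>F)"
  have B: "subring B R" "T \<subseteq> B" "B \<subseteq> U" if "B \<in> F" for B
    using F(1) that unfolding intermediate_rings_def by auto
  have carrier: "\<Union>F \<subseteq> carrier R" using B(3) U.subset_carrier by blast
  have G: "subring ?G R" using carrier by (rule generate_ring_is_subring)
  have BG: "B \<subseteq> ?G" if "B \<in> F" for B using that by (auto intro: generate_ring.incl)
  show "?G \<subseteq> U" using carrier U.is_subring by (rule generate_ring_min_subring1) (use B(3) in blast)
  show "ring_extension R T B \<and> ring_extension R B ?G" if "B \<in> F" for B
    using B[OF that] BG[OF that] G T.is_subring by (simp add: ring_extensionI)
  show "ring_extension R T ?G"
    using T.is_subring G by (rule ring_extensionI) (use F(2) B(2) BG in blast)
qed

lemma generate_ring_subset_fractions_mod: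
  assumes F: "F \<subseteq> intermediate_rings R T U" "F \<noteq> {}"
    and P: "subring_primeideal R (generate_ring R (\<Union>F)) P"
    and Q: "subring_primeideal R (generate_ring R (\<Union>F)) Q"
    and B: "\<And>B. B \<in> F \<Longrightarrow> B \<subseteq> ring_extension.fractions_mod R T B (T - Q \<inter> B) (P \<inter> B \<inter> (Q \<inter> B))"
  shows "generate_ring R (\<Union>F)
    \<subseteq> ring_extension.fractions_mod R T (generate_ring R (\<Union>F)) (T - Q) (P \<inter> Q)"
proof -
  let ?G = "generate_ring R (\<Union>F)"
  interpret G: ring_extension R T ?G using F by (rule generate_ring_Union)
  interpret P: subring_primeideal R ?G P by (rule P)
  interpret Q: subring_primeideal R ?G Q by (rule Q)
  have "subring_ideal R ?G (P \<inter> Q)" by unfold_locales auto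
  moreover have "v \<otimes> w \<in> T - Q" if "v \<in> T - Q" "w \<in> T - Q" for v w
    using that Q.prime[of v w] by auto
  ultimately have "subring (G.fractions_mod (T - Q) (P \<inter> Q)) R"
    by (intro G.subring_fractions_mod) simp_all
  moreover have "C \<subseteq> G.fractions_mod (T - Q) (P \<inter> Q)" if C: "C \<in> F" for C
  proof -
    interpret C: ring_extension R T C using generate_ring_Union(3)[OF F C] by blast
    interpret CG: ring_extension R C ?G using generate_ring_Union(3)[OF F C] by blast
    show ?thesis
      using B[OF C] C.subset CG.subset unfolding C.fractions_mod_def G.fractions_mod_def by fast
  qed
  then have "\<Union>F \<subseteq> G.fractions_mod (T - Q) (P \<inter> Q)" by blast
  moreover have "\<Union>F \<subseteq> carrier R"
    using F(1) U.subset_carrier unfolding intermediate_rings_def by blast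
  ultimately show ?thesis by (intro generate_ring_min_subring1)
qed

lemma infra_integral_generate_ring:
  assumes F: "F \<subseteq> intermediate_rings R T U" "F \<noteq> {}" and int: "integral_extension R T U"
    and infra: "\<forall>B\<in>F. infra_integral R T B"
  shows "infra_integral R T (generate_ring R (\<Union>F))"
proof -
  let ?G = "generate_ring R (\<Union>F)"
  note G = generate_ring_Union[OF F]
  interpret G: ring_extension R T ?G by (rule G)
  have "?G \<subseteq> G.fractions_mod (T - Q) (Q \<inter> Q)" if Q: "subring_primeideal R ?G Q" for Q
    using F Q Q
  proof (rule generate_ring_subset_fractions_mod)
    fix B assume B: "B \<in> F"
    interpret B: ring_extension R T B using G(3)[OF B] by blast
    interpret BG: ring_extension R B ?G using G(3)[OF B] by blast
    have "infra_integral R T B" using infra B by blast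
    then show "B \<subseteq> B.fractions_mod (T - Q \<inter> B) (Q \<inter> B \<inter> (Q \<inter> B))"
      using BG.subring_primeideal_Int[OF Q] unfolding B.infra_integral_iff by simp
  qed
  then show ?thesis
    using integral_extension_mono[OF int subset_refl G(2)] unfolding G.infra_integral_iff by simp
qed

lemma subintegral_generate_ring:
  assumes F: "F \<subseteq> intermediate_rings R T U" "F \<noteq> {}" and int: "integral_extension R T U"
    and sub: "\<forall>B\<in>F. subintegral R T B"
  shows "subintegral R T (generate_ring R (\<Union>F))"
proof -
  let ?G = "generate_ring R (\<Union>F)"
  note G = generate_ring_Union[OF F]
  interpret G: ring_extension R T ?G by (rule G)
  have "?G \<subseteq> G.fractions_mod (T - Q) (P \<inter> Q)"
    if P: "subring_primeideal R ?G P" and Q: "subring_primeideal R ?G Q"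
      and eq: "P \<inter> T = Q \<inter> T" for P Q
    using F P Q
  proof (rule generate_ring_subset_fractions_mod)
    fix B assume B: "B \<in> F"
    interpret B: ring_extension R T B using G(3)[OF B] by blast
    interpret BG: ring_extension R B ?G using G(3)[OF B] by blast
    have "subintegral R T B" using sub B by blast
    moreover have "(P \<inter> B) \<inter> T = (Q \<inter> B) \<inter> T" using eq by blast
    ultimately show "B \<subseteq> B.fractions_mod (T - Q \<inter> B) (P \<inter> B \<inter> (Q \<inter> B))"
      using BG.subring_primeideal_Int[OF P] BG.subring_primeideal_Int[OF Q]
      unfolding B.subintegral_iff by blast
  qed
  then show ?thesis
    using integral_extension_mono[OF int subset_refl G(2)] unfolding G.subintegral_iff by blast
qed

lemma GREATEST_intermediate_ring:
  assumes T: "P T" and union: "\<And>F. \<lbrakk>F \<subseteq> intermediate_rings R T U; F \<noteq> {}; \<forall>B\<in>F. P B\<rbrakk>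
      \<Longrightarrow> P (generate_ring R (\<Union>F))"
  defines "G \<equiv> GREATEST B. B \<in> intermediate_rings R T U \<and> P B"
  shows "G \<in> intermediate_rings R T U" "P G"
    "\<And>B. \<lbrakk>B \<in> intermediate_rings R T U; P B\<rbrakk> \<Longrightarrow> B \<subseteq> G"
proof -
  define F where "F = {B \<in> intermediate_rings R T U. P B}"
  have F: "F \<subseteq> intermediate_rings R T U" "F \<noteq> {}" "\<forall>B\<in>F. P B"
    using T subring_intermediate unfolding F_def by auto
  let ?G = "generate_ring R (\<Union>F)"
  interpret G: ring_extension R T ?G using F by (intro generate_ring_Union)
  have mem: "?G \<in> intermediate_rings R T U"
    using G.U.is_subring G.subset generate_ring_Union(2)[OF F(1,2)] by (rule intermediate_ringI)
  have upper: "B \<subseteq> ?G" if "B \<in> intermediate_rings R T U \<and> P B" for B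
    using generate_ring_Union(3)[OF F(1,2), of B] that ring_extension.subset
    unfolding F_def by blast
  have "G = ?G" unfolding G_def using mem union[OF F] upper by (intro Greatest_equality) auto
  then show "G \<in> intermediate_rings R T U" "P G"
    "\<And>B. \<lbrakk>B \<in> intermediate_rings R T U; P B\<rbrakk> \<Longrightarrow> B \<subseteq> G"
    using mem union[OF F] upper by auto
qed

lemma subintegral_refl:
  assumes "integral_extension R T U"
  shows "subintegral R T T"
proof -
  interpret self: ring_extension R T T
    using T.is_subring T.is_subring subset_refl by (rule ring_extensionI)
  have "x \<in> self.fractions_mod (T - Q) (P \<inter> Q)"
    if "subring_primeideal R T P" "subring_primeideal R T Q" and x: "x \<in> T" for P Q x
  proof -
    interpret P: subring_primeideal R T P by fact
    interpret Q: subring_primeideal R T Q by fact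
    have "\<one> \<otimes> x \<ominus> x = \<zero>" using x by algebra
    then have "\<one> \<otimes> x \<ominus> x \<in> P \<inter> Q" using P.zero_mem Q.zero_mem by (simp only: IntI)
    moreover have "\<one> \<in> T - Q" by simp
    ultimately show ?thesis using x unfolding self.fractions_mod_def by blast
  qed
  then show ?thesis
    using integral_extension_mono[OF assms subset_refl subset] unfolding self.subintegral_iff by blast
qed

lemma t_closure_greatest:
  assumes int: "integral_extension R T U"
  shows "t_closure R T U \<in> intermediate_rings R T U" "infra_integral R T (t_closure R T U)"
    "\<And>B. \<lbrakk>B \<in> intermediate_rings R T U; infra_integral R T B\<rbrakk> \<Longrightarrow> B \<subseteq> t_closure R T U"
proof -
  have "infra_integral R T T" using subintegral_refl[OF int] unfolding subintegral_def by blast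
  note GREATEST_intermediate_ring[where P = "infra_integral R T", folded t_closure_def,
      OF this infra_integral_generate_ring[OF _ _ int]]
  then show "t_closure R T U \<in> intermediate_rings R T U" "infra_integral R T (t_closure R T U)"
    "\<And>B. \<lbrakk>B \<in> intermediate_rings R T U; infra_integral R T B\<rbrakk> \<Longrightarrow> B \<subseteq> t_closure R T U"
    by blast+
qed

lemma seminormalization_greatest:
  assumes int: "integral_extension R T U"
  shows "seminormalization R T U \<in> intermediate_rings R T U"
    "subintegral R T (seminormalization R T U)"
    "\<And>B. \<lbrakk>B \<in> intermediate_rings R T U; subintegral R T B\<rbrakk> \<Longrightarrow> B \<subseteq> seminormalization R T U"
  using GREATEST_intermediate_ring[where P = "subintegral R T", folded seminormalization_def,
      OF subintegral_refl[OF int] subintegral_generate_ring[OF _ _ int]]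
  by blast+

theorem i_extension_imp_seminormalization_eq_t_closure:
  assumes int: "integral_extension R T U" and i: "i_extension R T U"
  shows "seminormalization R T U = t_closure R T U"
proof
  note t_closure = t_closure_greatest[OF int]
  note seminormalization = seminormalization_greatest[OF int]
  show "seminormalization R T U \<subseteq> t_closure R T U"
    using t_closure(3)[OF seminormalization(1)] seminormalization(2)
    unfolding subintegral_def by blast
  have "T \<subseteq> t_closure R T U" using t_closure(1) unfolding intermediate_rings_def by blast
  then have "i_extension R T (t_closure R T U)"
    using i_extension_intermediate[OF subring_intermediate t_closure(1) _ int i] by blast
  then show "t_closure R T U \<subseteq> seminormalization R T U"
    using seminormalization(3)[OF t_closure(1)] t_closure(2) unfolding subintegral_def by blast
qed

theorem seminormalization_eq_t_closure_imp_u_closed: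
  assumes int: "integral_extension R T U" and eq: "seminormalization R T U = t_closure R T U"
  shows "u_closed R T U"
  unfolding u_closed_iff
proof (intro ballI impI)
  note greatest = seminormalization_greatest[OF int]
  interpret SN: ring_extension R T "seminormalization R T U"
    using greatest(1) by (rule intermediate_ring_extension)
  have u_closed: "u_closed R T (seminormalization R T U)"
    using greatest(2) unfolding subintegral_def infra_integral_def
    by (blast intro: SN.i_extension_imp_u_closed)
  fix b assume b: "b \<in> U" and c: "b \<otimes> b \<ominus> b \<in> T" "(b \<otimes> b \<ominus> b) \<otimes> b \<in> T"
  interpret Tb: quadratic_extension R T b "b \<otimes> b \<ominus> b" \<one>
    using b c(1) by (rule quadratic_extension_anodal)
  have Tb: "line_extension T b T \<in> intermediate_rings R T U"
    using b c(1) by (rule line_extension_intermediate)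
  then have "integral_extension R T (line_extension T b T)"
    using integral_extension_mono[OF int subset_refl] unfolding intermediate_rings_def by blast
  then have "infra_integral R T (line_extension T b T)"
    unfolding Tb.T_b.infra_integral_iff using Tb.subset_fractions_mod[OF _ c(2)] by blast
  with Tb have "b \<in> seminormalization R T U"
    unfolding eq using t_closure_greatest(3)[OF int] Tb.b_mem by blast
  then show "b \<in> T" using u_closed c unfolding SN.u_closed_iff by blast
qed

end

subsection \<open>Minimal subextensions\<close>

lemma (in ring_hom_ring) subring_vimage:
  assumes "subring K S"
  shows "subring {x \<in> carrier R. h x \<in> K} R"
  using subringE[OF assms] by (intro R.subringI) auto

lemma (in ring_hom_ring) line_extension_image:
  assumes "K \<subseteq> carrier R" "a \<in> carrier R" "N \<subseteq> carrier R"
  shows "h ` R.line_extension K a N = S.line_extension (h ` K) (h a) (h ` N)"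
proof -
  have "h (k \<otimes> a \<oplus> n) = h k \<otimes>\<^bsub>S\<^esub> h a \<oplus>\<^bsub>S\<^esub> h n" if "k \<in> K" "n \<in> N" for k n
    using that assms by (simp add: subsetD)
  then show ?thesis
    by (force simp: R.line_extension_mem_iff S.line_extension_mem_iff)
qed

lemma (in cring_subring) subring_subring_iff:
  assumes "B \<subseteq> U"
  shows "subring B (sub_ring R U) \<longleftrightarrow> subring B R"
proof -
  have "B \<subseteq> carrier R" using assms subset_carrier by blast
  then show ?thesis
    using ring.subring_iff[OF cring.axioms(1)[OF is_cring_subring], of B] subring_iff[of B] assms
    by simp
qed

lemma (in subring_ideal) reduced_mult_mem:
  assumes reduced: "\<forall>z\<in>U. z \<otimes> z \<in> I \<longrightarrow> z \<in> I"
    and u: "u \<in> U" "v \<in> U" "u [^] (n::nat) \<otimes> v \<in> I"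
  shows "u \<otimes> v \<in> I"
proof -
  have "u [^] Suc n \<otimes> v = u \<otimes> (u [^] n \<otimes> v)"
    unfolding nat_pow_Suc using u(1,2) by algebra
  then have "u [^] Suc n \<otimes> v \<in> I" using u(1,3) by simp
  then show ?thesis
  proof (induct n)
    case (Suc n)
    have "(u [^] Suc n \<otimes> v) \<otimes> (u [^] Suc n \<otimes> v) = (u [^] n \<otimes> v) \<otimes> (u [^] Suc (Suc n) \<otimes> v)"
      unfolding nat_pow_Suc using u(1,2) by algebra
    also have "\<dots> \<in> I" using Suc.prems u(1,2) by simp
    finally have "(u [^] Suc n \<otimes> v) \<otimes> (u [^] Suc n \<otimes> v) \<in> I" .
    moreover have "u [^] Suc n \<otimes> v \<in> U" using u(1,2) by simp
    ultimately have "u [^] Suc n \<otimes> v \<in> I" using reduced by blast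
    then show ?case by (rule Suc.hyps)
  qed (use u(1) in simp)
qed

lemma (in minimal_ring_extension) minimal_extension_Quot:
  assumes I: "subring_ideal R U I" "I \<subseteq> T"
  shows "minimal_extension (sub_ring R U Quot I) ((\<lambda>t. I +> t) ` T) (carrier (sub_ring R U Quot I))"
proof -
  interpret I: subring_ideal R U I by (rule I)
  interpret coset: ring_hom_ring "sub_ring R U" "sub_ring R U Quot I" "\<lambda>u. I +> u"
    by (rule I.coset_ring_hom_ring)
  let ?E = "sub_ring R U Quot I" and ?K = "(\<lambda>t. I +> t) ` T"
  have mem: "u \<in> B" if "u \<in> U" "b \<in> B" "I +> u = I +> b" "subring B R" "T \<subseteq> B" "B \<subseteq> U" for u b B
  proof -
    interpret B: cring_subring R B using that(4) by (rule cring_subringI)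
    have "u \<ominus> b \<in> I" using that I.coset_eq_iff by blast
    then have "(u \<ominus> b) \<oplus> b \<in> B" using that(2,5) I(2) by auto
    moreover have "(u \<ominus> b) \<oplus> b = u" using that(1,2) by algebra
    ultimately show ?thesis by simp
  qed
  have K: "subring ?K ?E"
    using coset.img_is_subring T.is_subring U.subring_subring_iff[OF subset] by blast
  obtain u where u: "u \<in> U" "u \<notin> T" using subset proper by blast
  then have "I +> u \<notin> ?K" using mem[OF u(1), of _ T] T.is_subring subset by blast
  then have proper: "?K \<subset> carrier ?E" using u(1) subset unfolding carrier_subring_Quot by blast
  have "L = ?K \<or> L = carrier ?E" if L: "subring L ?E" "?K \<subseteq> L" "L \<subseteq> carrier ?E" for L
  proof -
    define B where "B = {u \<in> U. I +> u \<in> L}"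
    have "subring B R"
      using coset.subring_vimage[OF L(1)] U.subring_subring_iff[of B] unfolding B_def by auto
    moreover have "T \<subseteq> B" "B \<subseteq> U" using L(2) subset unfolding B_def by auto
    ultimately have "B \<in> intermediate_rings R T U" by (rule intermediate_ringI)
    then have "B = T \<or> B = U" using minimal unfolding minimal_extension_def by blast
    moreover have "L = (\<lambda>u. I +> u) ` B" using L(3) unfolding B_def carrier_subring_Quot by blast
    ultimately show ?thesis unfolding carrier_subring_Quot by blast
  qed
  then show ?thesis
    unfolding minimal_extension_def intermediate_rings_def
    using proper K coset.S.carrier_is_subring by blast
qed

context ring_extension
begin

lemma quot_map_ring_iso:
  assumes P: "subring_ideal R T P" and Q: "subring_ideal R U Q" and PQ: "Q \<inter> T = P"
    and cong: "\<And>u. u \<in> U \<Longrightarrow> \<exists>t\<in>T. u \<ominus> t \<in> Q"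
  shows "quot_map R Q \<in> ring_iso (sub_ring R T Quot P) (sub_ring R U Quot Q)"
proof -
  interpret Q: subring_ideal R U Q by (rule Q)
  have "P \<subseteq> Q" using PQ by blast
  have "carrier (sub_ring R U Quot Q) = (\<lambda>t. Q +> t) ` T"
    unfolding carrier_subring_Quot using cong Q.coset_eq_iff by (fastforce simp: image_iff)
  then have "bij_betw (quot_map R Q) (carrier (sub_ring R T Quot P)) (carrier (sub_ring R U Quot Q))"
    unfolding bij_betw_def quot_map_image[OF P Q \<open>P \<subseteq> Q\<close>] using quot_map_inj[OF P Q PQ] by simp
  then show ?thesis
    unfolding ring_iso_def using quot_map_ring_hom[OF P Q \<open>P \<subseteq> Q\<close>] by simp
qed

lemma maximalideal_if_cong:
  assumes P: "subring_maximalideal R T P" and Q: "subring_ideal R U Q" and PQ: "Q \<inter> T = P"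
    and cong: "\<And>u. u \<in> U \<Longrightarrow> \<exists>t\<in>T. u \<ominus> t \<in> Q"
  shows "subring_maximalideal R U Q"
proof -
  interpret P: subring_maximalideal R T P by (rule P)
  interpret Q: subring_ideal R U Q by (rule Q)
  show ?thesis
  proof unfold_locales
    show "\<one> \<notin> Q" using PQ P.one_notin T.one_mem by blast
  next
    fix u assume u: "u \<in> U" "u \<notin> Q"
    obtain t where t: "t \<in> T" "u \<ominus> t \<in> Q" using cong u(1) by blast
    have "t \<notin> P"
    proof
      assume "t \<in> P"
      then have "(u \<ominus> t) \<oplus> t \<in> Q" using t(2) PQ by auto
      moreover have "(u \<ominus> t) \<oplus> t = u" using u(1) t(1) by algebra
      ultimately show False using u(2) by simp
    qed
    then obtain v where v: "v \<in> T" "\<one> \<ominus> t \<otimes> v \<in> P" using P.ex_inverse t(1) by blast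
    have "\<one> \<ominus> u \<otimes> v = (\<one> \<ominus> t \<otimes> v) \<ominus> (u \<ominus> t) \<otimes> v" using u(1) t(1) v(1) by algebra
    also have "\<dots> \<in> Q" using t(2) v PQ by auto
    finally show "\<exists>v\<in>U. \<one> \<ominus> u \<otimes> v \<in> Q" using mem_overring[OF v(1)] ..
  qed
qed

lemma subfield_quot_map_image:
  assumes M: "subring_maximalideal R T M" and I: "subring_ideal R U I" "M \<subseteq> I" "\<one> \<notin> I"
  shows "subfield (quot_map R I ` carrier (sub_ring R T Quot M)) (sub_ring R U Quot I)"
proof -
  let ?k = "sub_ring R T Quot M" and ?E = "sub_ring R U Quot I"
  interpret M: subring_maximalideal R T M by (rule M)
  interpret I: subring_ideal R U I by (rule I)
  have "field ?k" using M.maximalideal T.is_cring_subring by (rule maximalideal.quotient_is_field)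
  moreover have "ring_hom_ring ?k ?E (quot_map R I)"
    using quot_map_ring_hom[OF M.subring_ideal_axioms I(1,2)]
      M.coset_ring_hom_ring I.coset_ring_hom_ring
    by (simp add: ring_hom_ring_def ring_hom_ring_axioms_def)
  moreover have "\<one>\<^bsub>?E\<^esub> \<noteq> \<zero>\<^bsub>?E\<^esub>"
    using I.coset_eq_ideal_iff[OF U.one_mem] I(3) unfolding I.coset_one zero_subring_Quot by simp
  ultimately show ?thesis
    using ring_hom_ring.img_is_subfield(2) field.carrier_is_subfield by blast
qed

lemma ideal_prod_line_extension_subset:
  assumes I: "subring_ideal R U I" and y: "y \<in> U" "y \<otimes> y \<in> I"
  shows "ideal_prod (sub_ring R U) (line_extension T y I) (line_extension T y I) \<subseteq> I"
proof
  interpret I: subring_ideal R U I by (rule I)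
  have product: "u \<otimes> v \<in> I" if uv: "u \<in> line_extension T y I" "v \<in> line_extension T y I" for u v
  proof -
    obtain s m t n where repr: "s \<in> T" "m \<in> I" "u = s \<otimes> y \<oplus> m" "t \<in> T" "n \<in> I" "v = t \<otimes> y \<oplus> n"
      using uv unfolding line_extension_mem_iff by blast
    have "u \<otimes> v = (s \<otimes> t) \<otimes> (y \<otimes> y) \<oplus> ((s \<otimes> y) \<otimes> n \<oplus> (t \<otimes> y \<oplus> n) \<otimes> m)"
      unfolding repr(3,6) using repr(1,2,4,5) y(1) by algebra
    also have "\<dots> \<in> I" using repr(1,2,4,5) y by simp
    finally show ?thesis .
  qed
  fix z assume "z \<in> ideal_prod (sub_ring R U) (line_extension T y I) (line_extension T y I)"
  then show "z \<in> I" by (induct rule: ideal_prod.induct) (use product in auto)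
qed

end

context minimal_integral_extension
begin

lemma inertI:
  assumes "subring_maximalideal R U (conductor R T U)"
  shows "inert R T U"
  unfolding inert_def Let_def Max_Spec_def mem_Collect_eq
    quot_map_image[OF conductor_ideal_subring conductor.subring_ideal_axioms subset_refl]
  using finite_extension minimal conductor_maximalideal[THEN subring_maximalideal.maximalideal]
    assms[THEN subring_maximalideal.maximalideal]
    minimal_extension_Quot[OF conductor.subring_ideal_axioms conductor_subset]
  by blast

lemma dimension_conductor_Quot:
  assumes y: "y \<in> U" "y \<notin> T" and U: "line_extension T y T = U"
  shows "ring.dimension (sub_ring R U Quot conductor R T U) 2
    (quot_map R (conductor R T U) ` carrier (sub_ring R T Quot conductor R T U))
    (carrier (sub_ring R U Quot conductor R T U))"
proof -
  let ?M = "conductor R T U"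
  let ?E = "sub_ring R U Quot ?M" and ?coset = "\<lambda>u. ?M +> u"
  let ?K = "quot_map R ?M ` carrier (sub_ring R T Quot ?M)"
  interpret M: subring_maximalideal R T ?M by (rule conductor_maximalideal)
  interpret coset: ring_hom_ring "sub_ring R U" ?E ?coset by (rule conductor.coset_ring_hom_ring)
  have K: "?K = ?coset ` T"
    by (rule quot_map_image[OF conductor_ideal_subring conductor.subring_ideal_axioms subset_refl])
  have "subfield ?K ?E"
    using conductor_maximalideal conductor.subring_ideal_axioms subset_refl M.one_notin
    by (rule subfield_quot_map_image)
  then have "coset.S.dimension 1 ?K ?K" by (rule coset.S.dimension_one)
  moreover have "?coset y \<notin> ?K"
  proof
    assume "?coset y \<in> ?K"
    then obtain t where t: "t \<in> T" "?coset y = ?coset t" unfolding K by blast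
    then have "(y \<ominus> t) \<oplus> t \<in> T" using conductor.coset_eq_iff[OF y(1)] conductor_subset by auto
    moreover have "(y \<ominus> t) \<oplus> t = y" using t(1) y(1) by algebra
    ultimately show False using y(2) by simp
  qed
  moreover have "coset.S.line_extension ?K (?coset y) ?K = carrier ?E"
    using coset.line_extension_image[of T y T] subset y(1) U
    unfolding K carrier_subring_Quot[where U = U] line_extension_consistent[OF U.is_subring] by simp
  moreover have "?coset y \<in> carrier ?E" using y(1) unfolding carrier_subring_Quot by blast
  ultimately show ?thesis
    using coset.S.dimension.Suc_dim[of "?coset y" ?K 1 ?K] by (simp add: numeral_2_eq_2)
qed

lemma ramifiedI:
  assumes y: "y \<in> U" "y \<notin> conductor R T U" "y \<otimes> y \<in> conductor R T U"
  shows "ramified R T U"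
proof -
  let ?M = "conductor R T U"
  interpret M: subring_maximalideal R T ?M by (rule conductor_maximalideal)
  have yT: "y \<notin> T" using M.prime[of y y] y by blast
  interpret Ty: quadratic_extension R T y "y \<otimes> y" \<zero>
    using y conductor_subset by unfold_locales auto
  have "line_extension T y T \<subseteq> U"
    using y(1) subset by (rule subring_module.line_extension_least[OF overring_module])
  then have U: "line_extension T y T = U"
    using intermediate_ring_eq[OF Ty.subring_line_extension] Ty.T_b.subset yT Ty.b_mem by blast
  let ?N = "line_extension T y ?M"
  note N = Ty.primeideal_line_extension
    [OF M.subring_primeideal_axioms _ y(3), unfolded U, OF subset_refl]
  interpret N: subring_primeideal R U ?N by (rule N)
  have cong: "\<exists>x\<in>T. u \<ominus> x \<in> ?N" if "u \<in> U" for u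
    using M.ex_diff_mem_line_extension[of y u] y(1) U that by simp
  have "ideal_prod (sub_ring R U) ?N ?N \<subseteq> ?M"
    using conductor.subring_ideal_axioms y(1,3) by (rule ideal_prod_line_extension_subset)
  moreover have "?M \<subset> ?N"
    using M.line_extension_superset[of y] y(1,2) by auto
  moreover have "quot_map R ?N \<in> ring_iso (sub_ring R T Quot ?M) (sub_ring R U Quot ?N)"
    using conductor_ideal_subring N.subring_ideal_axioms N(2) cong by (rule quot_map_ring_iso)
  moreover have "subring_maximalideal R U ?N"
    using conductor_maximalideal N.subring_ideal_axioms N(2) cong by (rule maximalideal_if_cong)
  ultimately show ?thesis
    using dimension_conductor_Quot[OF y(1) yT U] finite_extension minimal conductor_maximalideal
    unfolding ramified_def Let_def Max_Spec_def by (blast intro: subring_maximalideal.maximalideal)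
qed

text \<open>Strong \<open>\<pi>\<close>-regularity modulo the reduced ideal \<open>M\<close> gives \<open>u (1 - y u) \<in> M\<close>; the idempotent \<open>y u\<close>
  lies in \<open>T\<close> by u-closedness, hence is \<open>0\<close> or \<open>1\<close> modulo \<open>M\<close>.\<close>

lemma u_closed_reduced_imp_inert:
  assumes u_closed: "u_closed R T U"
    and reduced: "\<forall>z\<in>U. z \<otimes> z \<in> conductor R T U \<longrightarrow> z \<in> conductor R T U"
  shows "inert R T U"
proof (rule inertI)
  let ?M = "conductor R T U"
  interpret M: subring_maximalideal R T ?M by (rule conductor_maximalideal)
  have "strongly_pi_regular_mod U ?M"
    using integral conductor.subring_ideal_axioms conductor_maximalideal subset_refl
    by (rule integral_strongly_pi_regular_mod)
  show "subring_maximalideal R U ?M"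
  proof unfold_locales
    show "\<one> \<notin> ?M" by (rule M.one_notin)
  next
    fix u assume u: "u \<in> U" "u \<notin> ?M"
    obtain n y where y: "y \<in> U" "u [^] (n::nat) \<otimes> (\<one> \<ominus> y \<otimes> u) \<in> ?M"
      using \<open>strongly_pi_regular_mod U ?M\<close> u(1) unfolding strongly_pi_regular_mod_def by blast
    have "\<one> \<ominus> y \<otimes> u \<in> U" using u(1) y(1) by simp
    then have u_mem: "u \<otimes> (\<one> \<ominus> y \<otimes> u) \<in> ?M"
      using y(2) by (rule conductor.reduced_mult_mem[OF reduced u(1)])
    have "(y \<otimes> u) \<otimes> (y \<otimes> u) \<ominus> y \<otimes> u = \<ominus> (y \<otimes> (u \<otimes> (\<one> \<ominus> y \<otimes> u)))" using u(1) y(1) by algebra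
    also have "\<dots> \<in> ?M" using u_mem y(1) by simp
    finally have idem: "(y \<otimes> u) \<otimes> (y \<otimes> u) \<ominus> y \<otimes> u \<in> ?M" .
    have yu_mem: "y \<otimes> u \<in> T" using u_closed_idempotent_mem[OF u_closed _ idem] u(1) y(1) by simp
    have "y \<otimes> u \<notin> ?M"
    proof
      assume "y \<otimes> u \<in> ?M"
      then have "u \<otimes> (\<one> \<ominus> y \<otimes> u) \<oplus> u \<otimes> (y \<otimes> u) \<in> ?M" using u_mem u(1) by simp
      moreover have "u \<otimes> (\<one> \<ominus> y \<otimes> u) \<oplus> u \<otimes> (y \<otimes> u) = u" using u(1) y(1) by algebra
      ultimately show False using u(2) by simp
    qed
    moreover have "(y \<otimes> u) \<otimes> (\<one> \<ominus> y \<otimes> u) = y \<otimes> (u \<otimes> (\<one> \<ominus> y \<otimes> u))" using u(1) y(1) by algebra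
    then have "(y \<otimes> u) \<otimes> (\<one> \<ominus> y \<otimes> u) \<in> ?M" using u_mem y(1) by simp
    ultimately have "\<one> \<ominus> y \<otimes> u \<in> ?M" using M.prime[of "y \<otimes> u" "\<one> \<ominus> y \<otimes> u"] yu_mem by simp
    then show "\<exists>v\<in>U. \<one> \<ominus> u \<otimes> v \<in> ?M" using u(1) y(1) by (intro bexI[of _ y]) (simp_all add: m_comm)
  qed
qed

theorem u_closed_imp_ramified_or_inert:
  assumes "u_closed R T U"
  shows "ramified R T U \<or> inert R T U"
proof (cases "\<forall>z\<in>U. z \<otimes> z \<in> conductor R T U \<longrightarrow> z \<in> conductor R T U")
  case True
  then show ?thesis using u_closed_reduced_imp_inert[OF assms] by blast
next
  case False
  then show ?thesis using ramifiedI by blast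
qed

end

theorem (in ring_extension) u_closed_minimal_subextension:
  assumes int: "integral_extension R T U" and fcp: "FCP R T U" and u_closed: "u_closed R T U"
    and B: "B \<in> intermediate_rings R T U" and C: "C \<in> intermediate_rings R T U"
    and minimal: "minimal_extension R B C"
  shows "ramified R B C \<or> inert R B C"
proof -
  have int': "integral_extension R B C"
    using integral_extension_mono[OF int] B C unfolding intermediate_rings_def by blast
  interpret BC: minimal_integral_extension R B C
    using minimal int' by (rule minimal_integral_extensionI)
  have "i_extension R T U" using int fcp u_closed by (rule u_closed_imp_i_extension)
  with B C BC.subset int have "i_extension R B C" by (rule i_extension_intermediate)
  with int' have "u_closed R B C" by (rule BC.i_extension_imp_u_closed)
  then show ?thesis by (rule BC.u_closed_imp_ramified_or_inert)
qed

theorem proposition5p2: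
  fixes S :: "('a, 'b) ring_scheme" and R :: "'a set"
  assumes "cring S" and "subring R S" and "R \<subset> carrier S"
    and "integral_extension S R (carrier S)"
    and "FCP S R (carrier S)"
  shows "(u_closed S R (carrier S) \<longleftrightarrow> i_extension S R (carrier S)) \<and>
         (i_extension S R (carrier S) \<longleftrightarrow>
            seminormalization S R (carrier S) = t_closure S R (carrier S)) \<and>
         (u_closed S R (carrier S) \<longrightarrow>
            (\<forall>T\<in>intermediate_rings S R (carrier S). \<forall>U\<in>intermediate_rings S R (carrier S).
               minimal_extension S T U \<longrightarrow> ramified S T U \<or> inert S T U))"
proof -
  interpret S: cring S by (rule assms(1))
  interpret RS: ring_extension S R "carrier S"
    using assms(2) S.carrier_is_subring psubset_imp_subset[OF assms(3)] by (rule S.ring_extensionI)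
  show ?thesis
    using RS.u_closed_imp_i_extension[OF assms(4,5)] RS.i_extension_imp_u_closed[OF assms(4)]
      RS.i_extension_imp_seminormalization_eq_t_closure[OF assms(4)]
      RS.seminormalization_eq_t_closure_imp_u_closed[OF assms(4)]
      RS.u_closed_minimal_subextension[OF assms(4,5)] by blast
qed

end
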